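(* Let $G$ be a finite group acting linearly on $\mathbb{R}^n$, and let $$f(x)=\sum_{\alpha\in\mathcal{A}}c_\alpha\exp(\langle\alpha,x\rangle)+\sum_{\beta\in\mathcal{B}}c_\beta\exp(\langle\beta,x\rangle)$$ be a $G$-invariant signomial, where $\mathcal{A},\mathcal{B}\subset\mathbb{R}^n$ are disjoint nonempty finite sets, $c_\alpha>0$ for all $\alpha\in\mathcal{A}$ and $c_\beta<0$ for all $\beta\in\mathcal{B}$. Let $\hat{\mathcal{B}}$ be a set of orbit representatives for $\mathcal{B}$. Then $f\in C_{\mathrm{SAGE}}(\mathcal{A},\mathcal{B})$ if and only if for every $\hat\beta\in\hat{\mathcal{B}}$ there exist $c^{(\hat\beta)}\in\mathbb{R}_+^{\mathcal{A}}$ and $\nu^{(\hat\beta)}\in\mathbb{R}_+^{\mathcal{A}}$, both invariant under the action of $\mathrm{Stab}(\hat\beta)$, such that $$\sum_{\alpha\in\mathcal{A}}\nu^{(\hat\beta)}_\alpha(\alpha-\hat\beta)=0\quad\text{for every }\hat\beta\in\hat{\mathcal{B}},$$ $$D\big(\nu^{(\hat\beta)},e\cdot c^{(\hat\beta)}\big)\le c_{\hat\beta}\quad\text{for every }\hat\beta\in\hat{\mathcal{B}},$$ $$\sum_{\hat\beta\in\hat{\mathcal{B}}}\ \sum_{\sigma\in\mathrm{Stab}(\hat\beta)\backslash G}c^{(\hat\beta)}_{\sigma(\alpha)}\le c_\alpha\quad\text{for every }\alpha\in\mathcal{A}.$$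
   Context: Actions. $G$ acts linearly on $\mathbb{R}^n$ (the space of variables) on the left via a homomorphism $\varphi:G\to\mathrm{GL}_n(\mathbb{R})$, $\sigma(x)=\varphi(\sigma)(x)$. It acts on functions by $(\sigma f)(x)=f(\sigma^{-1}(x))$, and on exponent vectors $\alpha\in\mathbb{R}^n$ by the dual action $\sigma(\alpha)=\varphi(\sigma^{-1})^{\#}(\alpha)$, where $A^{\#}$ is the adjoint of $A$ with respect to the standard Euclidean inner product $\langle\cdot,\cdot\rangle$. Thus $\sigma$ maps $\sum_\alpha c_\alpha e^{\langle\alpha,x\rangle}$ to $\sum_\alpha c_\alpha e^{\langle\sigma(\alpha),x\rangle}$. A $G$-invariant $f$ satisfies $\sigma f=f$ for all $\sigma\in G$ (so, because of the sign conditions, $\mathcal{A}$ and $\mathcal{B}$ are $G$-stable). Orbit representatives. A set of orbit representatives $\hat{\mathcal{B}}$ for $\mathcal{B}$ is an inclusion-minimal subset of $\mathcal{B}$ with $G\cdot\hat{\mathcal{B}}=\mathcal{B}$ (exactly one element per orbit). $\mathrm{Stab}(\beta)=\{\sigma\in G:\sigma(\beta)=\beta\}$ (dual action). The notation $\sigma\in\mathrm{Stab}(\hat\beta)\backslash G$ means that $\sigma$ runs over a set of representatives of the right cosets $\mathrm{Stab}(\hat\beta)\,\sigma$. A vector $v\in\mathbb{R}^{\mathcal{A}}$ is invariant under $\mathrm{Stab}(\hat\beta)$ if $v_{\sigma(\alpha)}=v_\alpha$ for all $\alpha\in\mathcal{A}$, $\sigma\in\mathrm{Stab}(\hat\beta)$.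 Relative entropy. For $\nu,\gamma\in\mathbb{R}_+^{\mathcal{A}}$ (nonnegative vectors indexed by $\mathcal{A}$), $D(\nu,\gamma)=\sum_{\alpha\in\mathcal{A}}\nu_\alpha\ln(\nu_\alpha/\gamma_\alpha)\in\mathbb{R}\cup\{\infty\}$, with $0\cdot\ln\frac0y=0$ for $y\ge0$ and $y\cdot\ln\frac y0=\infty$ for $y>0$. Here $e$ is Euler's number. Cones. For a finite set $\mathcal{A}'\subset\mathbb{R}^n$ and $\beta\in\mathbb{R}^n\setminus\mathcal{A}'$, $C_{\mathrm{AGE}}(\mathcal{A}',\beta)$ is the set of functions $\sum_{\alpha\in\mathcal{A}'}c_\alpha e^{\langle\alpha,x\rangle}+c_\beta e^{\langle\beta,x\rangle}$ with $c_\alpha\ge0$ for $\alpha\in\mathcal{A}'$, $c_\beta\in\mathbb{R}$, that are nonnegative on $\mathbb{R}^n$. For disjoint finite $\mathcal{A}\ne\emptyset$ and $\mathcal{B}$, the signed SAGE cone is the Minkowski sum $C_{\mathrm{SAGE}}(\mathcal{A},\mathcal{B})=\sum_{\beta\in\mathcal{B}}C_{\mathrm{AGE}}\big((\mathcal{A}\cup\mathcal{B})\setminus\{\beta\},\beta\big)$. *)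

theory Defs
  imports
    "HOL-Analysis.Analysis"
    "HOL-Algebra.Group_Action"
    "HOL-Library.Function_Algebras"
    "HOL-Library.Set_Algebras"
begin

definition GL :: "(real^'n^'n) monoid" where
  "GL = \<lparr>carrier = {M. invertible M}, mult = (**), one = mat 1\<rparr>"

definition fun_action ::
  "('g, 'm) monoid_scheme \<Rightarrow> ('g \<Rightarrow> real^'n^'n) \<Rightarrow> 'g \<Rightarrow> (real^'n \<Rightarrow> real) \<Rightarrow> real^'n \<Rightarrow> real" where
  "fun_action G \<phi> \<sigma> f = (\<lambda>x. f (\<phi> (inv\<^bsub>G\<^esub> \<sigma>) *v x))"

definition dual_action ::
  "('g, 'm) monoid_scheme \<Rightarrow> ('g \<Rightarrow> real^'n^'n) \<Rightarrow> 'g \<Rightarrow> real^'n \<Rightarrow> real^'n" where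
  "dual_action G \<phi> \<sigma> \<alpha> = adjoint (\<lambda>x. \<phi> (inv\<^bsub>G\<^esub> \<sigma>) *v x) \<alpha>"

definition orbit_representatives ::
  "('g, 'm) monoid_scheme \<Rightarrow> ('g \<Rightarrow> 'v \<Rightarrow> 'v) \<Rightarrow> 'v set \<Rightarrow> 'v set \<Rightarrow> bool" where
  "orbit_representatives G act B R \<longleftrightarrow>
     R \<subseteq> B \<and> (\<Union>\<beta>\<in>R. orbit G act \<beta>) = B \<and> (\<forall>S. S \<subset> R \<longrightarrow> (\<Union>\<beta>\<in>S. orbit G act \<beta>) \<noteq> B)"

definition right_coset_representatives ::
  "('g, 'm) monoid_scheme \<Rightarrow> 'g set \<Rightarrow> 'g set \<Rightarrow> bool" where
  "right_coset_representatives G H T \<longleftrightarrow>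
     T \<subseteq> carrier G \<and> (\<forall>K \<in> rcosets\<^bsub>G\<^esub> H. \<exists>!\<sigma>. \<sigma> \<in> T \<and> \<sigma> \<in> K)"

definition invariant_vector ::
  "('g \<Rightarrow> 'v \<Rightarrow> 'v) \<Rightarrow> 'g set \<Rightarrow> 'v set \<Rightarrow> ('v \<Rightarrow> real) \<Rightarrow> bool" where
  "invariant_vector act H A v \<longleftrightarrow> (\<forall>\<alpha>\<in>A. \<forall>\<sigma>\<in>H. v (act \<sigma> \<alpha>) = v \<alpha>)"

definition rel_entropy :: "'v set \<Rightarrow> ('v \<Rightarrow> real) \<Rightarrow> ('v \<Rightarrow> real) \<Rightarrow> ereal" where
  "rel_entropy A \<nu> \<gamma> =
     (\<Sum>\<alpha>\<in>A. if \<nu> \<alpha> = 0 then 0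
            else if \<gamma> \<alpha> = 0 then \<infinity>
            else ereal (\<nu> \<alpha> * ln (\<nu> \<alpha> / \<gamma> \<alpha>)))"

definition signomial :: "(real^'n) set \<Rightarrow> (real^'n \<Rightarrow> real) \<Rightarrow> real^'n \<Rightarrow> real" where
  "signomial A c = (\<lambda>x. \<Sum>\<alpha>\<in>A. c \<alpha> * exp (\<alpha> \<bullet> x))"

definition C_AGE :: "(real^'n) set \<Rightarrow> real^'n \<Rightarrow> (real^'n \<Rightarrow> real) set" where
  "C_AGE A \<beta> = {f. \<exists>c b. (\<forall>\<alpha>\<in>A. 0 \<le> c \<alpha>) \<and>
                        f = (\<lambda>x. signomial A c x + b * exp (\<beta> \<bullet> x)) \<and>
                        (\<forall>x. 0 \<le> f x)}"

text \<open>The outer sum is the Minkowski sum from \<^theory>\<open>HOL-Library.Set_Algebras\<close>, over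
  sets of real functions with pointwise addition.\<close>

definition C_SAGE :: "(real^'n) set \<Rightarrow> (real^'n) set \<Rightarrow> (real^'n \<Rightarrow> real) set" where
  "C_SAGE A B = (\<Sum>\<beta>\<in>B. C_AGE ((A \<union> B) - {\<beta>}) \<beta>)"

end

(* Nonnegativity of an AGE function is equivalent to a relative entropy certificate. Given
   nonnegativity, minimize the sum of c_alpha exp(<alpha - beta, x>) plus eps |x|^2: the terms at
   the minimizer form an approximate certificate, and these converge along eps -> 0 since they
   stay bounded.

   In a SAGE decomposition of f the summand at beta is the only one with a negative coefficient
   at beta, so Gaussian elimination, which only uses positive multipliers here, removes all
   coefficients at elements of B other than beta from it. Averaging over G makes the resulting
   family of coefficients equivariant, and averaging the certificates over stabilizers keeps them
   valid because t ln t is convex. Conversely, translating the certificates of the representatives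
   along right cosets of the stabilizers gives one AGE function per element of B. *)
theory Submission
  imports Defs "HOL-Real_Asymp.Real_Asymp"
begin

text \<open>The infimum of the exponential sum need not be attained, for instance when all \<alpha>
  - \<beta> lie in an open half space. The quadratic term forces a minimizer; even if these
  minimizers escape to infinity as \<epsilon> tends to 0, the gradient 2 \<epsilon> x of that term
  vanishes in the limit. Elimination has nonnegative multipliers because, at \<delta> in B, every
  summand except the one belonging to \<delta> has a nonnegative coefficient while the total is
  negative: the pivot must be negative. The result depends on the order in which B is processed, so
  it is not equivariant, and the average over G comes after it; averaging does not bring back
  removed terms. Only then can the certificates be indexed by A alone. Linear independence of
  exponentials serves twice: it turns a decomposition of f into equations between coefficients, and
  it derives the stability of A and B from the invariance of f. The index \<sigma>(\<alpha>) in the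
  last condition arises because translating the AGE function of \<beta> by the inverse of \<sigma>
  moves its exponent to the image of \<beta> under that inverse, and this image depends only on the
  right coset of \<sigma>.\<close>

section \<open>Linear independence of exponentials\<close>

text \<open>Among the exponents with nonzero coefficient, one of maximal norm, \<mu>, is the only
  maximizer of the inner product with \<mu>, since the norm of \<gamma> - \<mu> is positive for
  every other \<gamma>. Along the ray through \<mu> its term dominates, so its coefficient would be
  0.\<close>

lemma signomial_eq_zeroD:
  fixes c :: "real^'n \<Rightarrow> real"
  assumes "finite S" and zero: "\<And>x. signomial S c x = 0" and "\<alpha> \<in> S"
  shows "c \<alpha> = 0"
proof (rule ccontr)
  assume "c \<alpha> \<noteq> 0"
  define S' where "S' = {\<gamma>\<in>S. c \<gamma> \<noteq> 0}"
  have fin: "finite S'" and ne: "S' \<noteq> {}"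
    using assms \<open>c \<alpha> \<noteq> 0\<close> by (auto simp: S'_def)
  have "Max (norm ` S') \<in> norm ` S'"
    using fin ne by simp
  then obtain \<mu> where \<mu>: "\<mu> \<in> S'" and "norm \<mu> = Max (norm ` S')"
    by auto
  then have max: "\<And>\<gamma>. \<gamma> \<in> S' \<Longrightarrow> norm \<gamma> \<le> norm \<mu>"
    using fin by simp
  have less: "\<gamma> \<bullet> \<mu> < \<mu> \<bullet> \<mu>" if "\<gamma> \<in> S'" "\<gamma> \<noteq> \<mu>" for \<gamma>
  proof -
    have "\<gamma> \<bullet> \<gamma> \<le> \<mu> \<bullet> \<mu>"
      using max[OF that(1)] by (simp add: norm_le)
    moreover have "0 < (\<gamma> - \<mu>) \<bullet> (\<gamma> - \<mu>)"
      using that(2) by simp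
    ultimately show ?thesis
      by (simp add: inner_diff inner_commute)
  qed
  have eq0: "(\<Sum>\<gamma>\<in>S'. c \<gamma> * exp (t * (\<gamma> \<bullet> \<mu> - \<mu> \<bullet> \<mu>))) = 0" for t
  proof -
    have "(\<Sum>\<gamma>\<in>S'. c \<gamma> * exp (t * (\<gamma> \<bullet> \<mu> - \<mu> \<bullet> \<mu>)))
        = (\<Sum>\<gamma>\<in>S'. c \<gamma> * exp (\<gamma> \<bullet> (t *\<^sub>R \<mu>))) / exp (t * (\<mu> \<bullet> \<mu>))"
      by (simp add: sum_divide_distrib right_diff_distrib exp_diff)
    also have "(\<Sum>\<gamma>\<in>S'. c \<gamma> * exp (\<gamma> \<bullet> (t *\<^sub>R \<mu>))) = signomial S c (t *\<^sub>R \<mu>)"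
      unfolding signomial_def S'_def by (rule sum.mono_neutral_left) (use assms in auto)
    finally show ?thesis
      using zero by simp
  qed
  have "((\<lambda>t. c \<gamma> * exp (t * (\<gamma> \<bullet> \<mu> - \<mu> \<bullet> \<mu>))) \<longlongrightarrow> (if \<gamma> = \<mu> then c \<mu> else 0)) at_top"
    if "\<gamma> \<in> S'" for \<gamma>
  proof (cases "\<gamma> = \<mu>")
    case False
    define d where "d = \<gamma> \<bullet> \<mu> - \<mu> \<bullet> \<mu>"
    have "d < 0"
      using less[OF that False] by (simp add: d_def)
    then have "((\<lambda>t. c \<gamma> * exp (t * d)) \<longlongrightarrow> 0) at_top"
      by real_asymp
    then show ?thesis
      using False by (simp add: d_def)
  qed simp
  then have "((\<lambda>t. \<Sum>\<gamma>\<in>S'. c \<gamma> * exp (t * (\<gamma> \<bullet> \<mu> - \<mu> \<bullet> \<mu>)))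
      \<longlongrightarrow> (\<Sum>\<gamma>\<in>S'. if \<gamma> = \<mu> then c \<mu> else 0)) at_top"
    by (intro tendsto_sum) auto
  then have "c \<mu> = 0"
    using fin \<mu> by (simp add: eq0 tendsto_const_iff)
  then show False
    using \<mu> by (simp add: S'_def)
qed

lemma signomial_eqD:
  fixes c d :: "real^'n \<Rightarrow> real"
  assumes "finite S" and "\<And>x. signomial S c x = signomial S d x" and "\<alpha> \<in> S"
  shows "c \<alpha> = d \<alpha>"
  using signomial_eq_zeroD[of S "\<lambda>\<alpha>. c \<alpha> - d \<alpha>" \<alpha>] assms
  by (simp add: signomial_def left_diff_distrib sum_subtractf)

section \<open>Relative entropy certificates of AGE functions\<close>

text \<open>The left side is the tangent at \<open>s\<close> of the convex function
  \<open>t * ln t\<close>. It gives both the sufficiency of certificates and Jensen's inequality for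
  averages of certificates.\<close>

lemma entropy_tangent:
  fixes s t :: real
  assumes "0 < s" "0 \<le> t"
  shows "t * ln s + t - s \<le> t * ln t"
proof (cases "t = 0")
  case False
  then have "ln (s / t) \<le> s / t - 1"
    using assms by (intro ln_le_minus_one) auto
  then have "t * (ln s - ln t) \<le> t * (s / t - 1)"
    using assms False by (simp add: ln_div)
  then show ?thesis
    using False by (simp add: algebra_simps)
qed (use assms in simp)

text \<open>A limit certificate may have zero entries, where \<open>ln\<close> is not continuous;
  the product still converges because positive values approach 0 from the right.\<close>

lemma tendsto_mult_ln:
  fixes u :: "'a \<Rightarrow> real"
  assumes lim: "(u \<longlongrightarrow> l) F" and pos: "\<And>k. 0 < u k"
  shows "((\<lambda>k. u k * ln (u k)) \<longlongrightarrow> l * ln l) F"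
proof (cases "l = 0")
  case True
  have "((\<lambda>t::real. t * ln t) \<longlongrightarrow> 0) (at_right 0)"
    by real_asymp
  moreover have "filterlim u (at_right 0) F"
    using lim pos True by (auto simp: filterlim_at less_imp_neq[symmetric])
  ultimately show ?thesis
    using True filterlim_compose[of "\<lambda>t. t * ln t"] by simp
qed (use lim in \<open>intro tendsto_intros\<close>)

text \<open>Separates the infinite case, as a condition on supports, from a real inequality in which
  \<open>\<nu> \<alpha> * ln (\<nu> \<alpha>)\<close> is the only part that is not linear in \<nu>.
  The summand 1 is the logarithm of Euler's number.\<close>

lemma rel_entropy_le_iff:
  fixes c \<nu> :: "'v \<Rightarrow> real"
  assumes "finite A" and "\<And>\<alpha>. \<alpha> \<in> A \<Longrightarrow> 0 \<le> c \<alpha>" and "\<And>\<alpha>. \<alpha> \<in> A \<Longrightarrow> 0 \<le> \<nu> \<alpha>"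
  shows "rel_entropy A \<nu> (\<lambda>\<alpha>. exp 1 * c \<alpha>) \<le> ereal b \<longleftrightarrow>
    (\<forall>\<alpha>\<in>A. c \<alpha> = 0 \<longrightarrow> \<nu> \<alpha> = 0) \<and> (\<Sum>\<alpha>\<in>A. \<nu> \<alpha> * ln (\<nu> \<alpha>) - \<nu> \<alpha> * (1 + ln (c \<alpha>))) \<le> b"
proof (cases "\<forall>\<alpha>\<in>A. c \<alpha> = 0 \<longrightarrow> \<nu> \<alpha> = 0")
  case True
  have "rel_entropy A \<nu> (\<lambda>\<alpha>. exp 1 * c \<alpha>)
      = (\<Sum>\<alpha>\<in>A. ereal (\<nu> \<alpha> * ln (\<nu> \<alpha>) - \<nu> \<alpha> * (1 + ln (c \<alpha>))))"
    unfolding rel_entropy_def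
  proof (rule sum.cong[OF refl])
    fix \<alpha> assume \<alpha>: "\<alpha> \<in> A"
    show "(if \<nu> \<alpha> = 0 then 0 else if exp 1 * c \<alpha> = 0 then \<infinity>
        else ereal (\<nu> \<alpha> * ln (\<nu> \<alpha> / (exp 1 * c \<alpha>))))
      = ereal (\<nu> \<alpha> * ln (\<nu> \<alpha>) - \<nu> \<alpha> * (1 + ln (c \<alpha>)))"
    proof (cases "\<nu> \<alpha> = 0")
      case False
      then have "0 < \<nu> \<alpha>" "0 < c \<alpha>"
        using assms(2,3)[OF \<alpha>] True \<alpha> by force+
      then show ?thesis
        by (simp add: ln_div ln_mult right_diff_distrib)
    qed simp
  qed
  then show ?thesis
    using True by simp
next
  case False
  then have "rel_entropy A \<nu> (\<lambda>\<alpha>. exp 1 * c \<alpha>) = \<infinity>"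
    using assms(1) unfolding rel_entropy_def by (auto simp: sum_Pinfty)
  then show ?thesis
    using False by auto
qed

text \<open>After division by \<open>exp (\<beta> \<bullet> x)\<close>, each term is bounded below
  by the tangent inequality with
  \<open>s = c \<alpha> * exp ((\<alpha> - \<beta>) \<bullet> x)\<close> and
  \<open>t = \<nu> \<alpha>\<close>. The parts linear in x cancel in the sum by the balance
  condition.\<close>

lemma age_nonneg_if_entropy:
  fixes \<beta> :: "real^'n" and c \<nu> :: "real^'n \<Rightarrow> real"
  assumes "finite A" and c: "\<And>\<alpha>. \<alpha> \<in> A \<Longrightarrow> 0 \<le> c \<alpha>" and \<nu>: "\<And>\<alpha>. \<alpha> \<in> A \<Longrightarrow> 0 \<le> \<nu> \<alpha>"
    and bal: "(\<Sum>\<alpha>\<in>A. \<nu> \<alpha> *\<^sub>R (\<alpha> - \<beta>)) = 0"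
    and ent: "rel_entropy A \<nu> (\<lambda>\<alpha>. exp 1 * c \<alpha>) \<le> ereal b"
  shows "0 \<le> signomial A c x + b * exp (\<beta> \<bullet> x)"
proof -
  have supp: "\<And>\<alpha>. \<alpha> \<in> A \<Longrightarrow> c \<alpha> = 0 \<Longrightarrow> \<nu> \<alpha> = 0"
    and ent': "(\<Sum>\<alpha>\<in>A. \<nu> \<alpha> * ln (\<nu> \<alpha>) - \<nu> \<alpha> * (1 + ln (c \<alpha>))) \<le> b"
    using ent rel_entropy_le_iff[OF assms(1) c \<nu>] by auto
  have "0 \<le> (\<Sum>\<alpha>\<in>A. c \<alpha> * exp ((\<alpha> - \<beta>) \<bullet> x) - \<nu> \<alpha> * ((\<alpha> - \<beta>) \<bullet> x)
      + (\<nu> \<alpha> * ln (\<nu> \<alpha>) - \<nu> \<alpha> * (1 + ln (c \<alpha>))))"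
  proof (rule sum_nonneg)
    fix \<alpha> assume \<alpha>: "\<alpha> \<in> A"
    show "0 \<le> c \<alpha> * exp ((\<alpha> - \<beta>) \<bullet> x) - \<nu> \<alpha> * ((\<alpha> - \<beta>) \<bullet> x)
      + (\<nu> \<alpha> * ln (\<nu> \<alpha>) - \<nu> \<alpha> * (1 + ln (c \<alpha>)))"
    proof (cases "c \<alpha> = 0")
      case False
      then have "0 < c \<alpha>"
        using c[OF \<alpha>] by simp
      then show ?thesis
        using entropy_tangent[of "c \<alpha> * exp ((\<alpha> - \<beta>) \<bullet> x)" "\<nu> \<alpha>"] \<nu>[OF \<alpha>]
        by (simp add: ln_mult algebra_simps)
    qed (use supp[OF \<alpha>] in simp)
  qed
  also have "\<dots> = (\<Sum>\<alpha>\<in>A. c \<alpha> * exp ((\<alpha> - \<beta>) \<bullet> x)) - (\<Sum>\<alpha>\<in>A. \<nu> \<alpha> *\<^sub>R (\<alpha> - \<beta>)) \<bullet> x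
      + (\<Sum>\<alpha>\<in>A. \<nu> \<alpha> * ln (\<nu> \<alpha>) - \<nu> \<alpha> * (1 + ln (c \<alpha>)))"
    by (simp add: sum.distrib sum_subtractf inner_sum_left)
  also have "\<dots> \<le> (\<Sum>\<alpha>\<in>A. c \<alpha> * exp ((\<alpha> - \<beta>) \<bullet> x)) + b"
    using ent' bal by simp
  finally have "0 \<le> ((\<Sum>\<alpha>\<in>A. c \<alpha> * exp ((\<alpha> - \<beta>) \<bullet> x)) + b) * exp (\<beta> \<bullet> x)"
    by simp
  also have "\<dots> = signomial A c x + b * exp (\<beta> \<bullet> x)"
    by (simp add: signomial_def distrib_right sum_distrib_right mult.assoc exp_add[symmetric]
        inner_diff_left)
  finally show ?thesis .
qed

lemma convergent_coordinates_subseq: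
  fixes u :: "nat \<Rightarrow> 'a \<Rightarrow> real"
  assumes "finite A" and "\<And>k \<alpha>. \<alpha> \<in> A \<Longrightarrow> \<bar>u k \<alpha>\<bar> \<le> M"
  shows "\<exists>r v. strict_mono r \<and> (\<forall>\<alpha>\<in>A. (\<lambda>k. u (r k) \<alpha>) \<longlonglongrightarrow> v \<alpha>)"
  using assms
proof (induction A rule: finite_induct)
  case empty
  show ?case
    using strict_mono_id by auto
next
  case (insert a A)
  then obtain r v where r: "strict_mono r" and v: "\<And>\<alpha>. \<alpha> \<in> A \<Longrightarrow> (\<lambda>k. u (r k) \<alpha>) \<longlonglongrightarrow> v \<alpha>"
    by (meson insertI2)
  have "bounded (range (\<lambda>k. u (r k) a))"
    using insert.prems by (auto simp: bounded_iff)
  then obtain l s where s: "strict_mono s" and l: "((\<lambda>k. u (r k) a) \<circ> s) \<longlonglongrightarrow> l"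
    using bounded_imp_convergent_subsequence by blast
  have "(\<lambda>k. u ((r \<circ> s) k) \<alpha>) \<longlonglongrightarrow> (v(a := l)) \<alpha>" if "\<alpha> \<in> insert a A" for \<alpha>
    using l LIMSEQ_subseq_LIMSEQ[OF v s] that by (cases "\<alpha> = a") (auto simp: o_def)
  then show ?case
    using strict_mono_o[OF r s] by blast
qed

text \<open>The quadratic term makes the function coercive, so a global minimizer exists. The
  equation is its vanishing gradient, the inequality a comparison with the value at 0.\<close>

lemma regularized_stationary_point:
  fixes w :: "'i \<Rightarrow> 'a::euclidean_space" and c :: "'i \<Rightarrow> real"
  assumes "finite A" and c: "\<And>\<alpha>. \<alpha> \<in> A \<Longrightarrow> 0 \<le> c \<alpha>" and "0 < \<epsilon>"
  shows "\<exists>x. (\<Sum>\<alpha>\<in>A. (c \<alpha> * exp (w \<alpha> \<bullet> x)) *\<^sub>R w \<alpha>) + (2 * \<epsilon>) *\<^sub>R x = 0 \<and>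
    (\<Sum>\<alpha>\<in>A. c \<alpha> * exp (w \<alpha> \<bullet> x)) + \<epsilon> * (x \<bullet> x) \<le> (\<Sum>\<alpha>\<in>A. c \<alpha>)"
proof -
  define h where "h = (\<lambda>x. (\<Sum>\<alpha>\<in>A. c \<alpha> * exp (w \<alpha> \<bullet> x)) + \<epsilon> * (x \<bullet> x))"
  define M where "M = (\<Sum>\<alpha>\<in>A. c \<alpha>)"
  \<comment> \<open>Outside this ball the norm of y is at least \<open>R\<close>, and
    \<open>R\<close> is at least 1, so the quadratic term is at least
    \<open>\<epsilon> * R = M + \<epsilon>\<close>, which exceeds the value \<open>M\<close> at
    0.\<close>
  define R where "R = M / \<epsilon> + 1"
  have h0: "h 0 = M"
    by (simp add: h_def M_def)
  have "0 \<le> M"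
    using c by (simp add: M_def sum_nonneg)
  then have "1 \<le> R"
    using \<open>0 < \<epsilon>\<close> by (simp add: R_def)
  have "continuous_on (cball 0 R) h"
    unfolding h_def by (intro continuous_intros)
  then have "\<exists>x\<in>cball 0 R. \<forall>y\<in>cball 0 R. h x \<le> h y"
    using \<open>1 \<le> R\<close> by (intro continuous_attains_inf) auto
  then obtain x where min_cball: "\<And>y. y \<in> cball 0 R \<Longrightarrow> h x \<le> h y"
    by blast
  have hx: "h x \<le> M"
    using min_cball[of 0] h0 \<open>1 \<le> R\<close> by simp
  have min: "h x \<le> h y" for y
  proof (cases "y \<in> cball 0 R")
    case False
    then have "R \<le> norm y"
      by simp
    have "h x \<le> \<epsilon> * R"
      using hx \<open>0 < \<epsilon>\<close> by (simp add: R_def distrib_left)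
    also have "\<dots> \<le> \<epsilon> * (norm y * norm y)"
      using \<open>1 \<le> R\<close> \<open>R \<le> norm y\<close> \<open>0 < \<epsilon>\<close> mult_mono[of 1 "norm y" R "norm y"] by simp
    also have "\<dots> \<le> h y"
      using c by (simp add: h_def sum_nonneg dot_square_norm power2_eq_square)
    finally show ?thesis .
  qed (rule min_cball)
  have "(h has_derivative
      (\<lambda>v. (\<Sum>\<alpha>\<in>A. c \<alpha> * (exp (w \<alpha> \<bullet> x) * (w \<alpha> \<bullet> v))) + \<epsilon> * (x \<bullet> v + v \<bullet> x))) (at x)"
    unfolding h_def by (auto intro!: derivative_eq_intros simp: mult.commute)
  from differential_zero_maxmin[OF UNIV_I open_UNIV this] min
  have "(\<lambda>v. (\<Sum>\<alpha>\<in>A. c \<alpha> * (exp (w \<alpha> \<bullet> x) * (w \<alpha> \<bullet> v))) + \<epsilon> * (x \<bullet> v + v \<bullet> x)) = (\<lambda>v. 0)"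
    by blast
  then have "((\<Sum>\<alpha>\<in>A. (c \<alpha> * exp (w \<alpha> \<bullet> x)) *\<^sub>R w \<alpha>) + (2 * \<epsilon>) *\<^sub>R x) \<bullet> v = 0" for v
    by (auto dest!: fun_cong[where x = v]
        simp: inner_add_left inner_sum_left inner_commute[of v x] mult.assoc)
  then have "(\<Sum>\<alpha>\<in>A. (c \<alpha> * exp (w \<alpha> \<bullet> x)) *\<^sub>R w \<alpha>) + (2 * \<epsilon>) *\<^sub>R x = 0"
    by (rule iffD1[OF inner_eq_zero_iff])
  then show ?thesis
    using hx unfolding h_def M_def by (intro exI[of _ x]) simp
qed

lemma entropy_if_age_nonneg:
  fixes \<beta> :: "real^'n" and c :: "real^'n \<Rightarrow> real"
  assumes "finite A" and c: "\<And>\<alpha>. \<alpha> \<in> A \<Longrightarrow> 0 \<le> c \<alpha>"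
    and nonneg: "\<And>x. 0 \<le> signomial A c x + b * exp (\<beta> \<bullet> x)"
  shows "\<exists>\<nu>. (\<forall>\<alpha>\<in>A. 0 \<le> \<nu> \<alpha>) \<and> (\<Sum>\<alpha>\<in>A. \<nu> \<alpha> *\<^sub>R (\<alpha> - \<beta>)) = 0 \<and>
    rel_entropy A \<nu> (\<lambda>\<alpha>. exp 1 * c \<alpha>) \<le> ereal b"
proof -
  define M where "M = (\<Sum>\<alpha>\<in>A. c \<alpha>)"
  define \<epsilon> where "\<epsilon> = (\<lambda>k. inverse (real (Suc k)))"
  have \<epsilon>: "0 < \<epsilon> k" for k
    by (simp add: \<epsilon>_def)
  have \<epsilon>_lim: "\<epsilon> \<longlonglongrightarrow> 0"
    unfolding \<epsilon>_def by (rule LIMSEQ_inverse_real_of_nat)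
  have "\<forall>k. \<exists>x. (\<Sum>\<alpha>\<in>A. (c \<alpha> * exp ((\<alpha> - \<beta>) \<bullet> x)) *\<^sub>R (\<alpha> - \<beta>)) + (2 * \<epsilon> k) *\<^sub>R x = 0 \<and>
      (\<Sum>\<alpha>\<in>A. c \<alpha> * exp ((\<alpha> - \<beta>) \<bullet> x)) + \<epsilon> k * (x \<bullet> x) \<le> M"
    unfolding M_def by (intro allI regularized_stationary_point assms(1) c \<epsilon>)
  from choice[OF this] obtain x
    where stat: "\<And>k. (\<Sum>\<alpha>\<in>A. (c \<alpha> * exp ((\<alpha> - \<beta>) \<bullet> x k)) *\<^sub>R (\<alpha> - \<beta>)) + (2 * \<epsilon> k) *\<^sub>R x k = 0"
      and bound: "\<And>k. (\<Sum>\<alpha>\<in>A. c \<alpha> * exp ((\<alpha> - \<beta>) \<bullet> x k)) + \<epsilon> k * (x k \<bullet> x k) \<le> M"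
    by blast
  define u where "u = (\<lambda>k \<alpha>. c \<alpha> * exp ((\<alpha> - \<beta>) \<bullet> x k))"
  have u0: "0 \<le> u k \<alpha>" if "\<alpha> \<in> A" for k \<alpha>
    using c[OF that] by (simp add: u_def)
  \<comment> \<open>Nonnegativity of the AGE function enters only here, evaluated at the stationary
    points and divided by \<open>exp (\<beta> \<bullet> x k)\<close>.\<close>
  have sum_u: "- b \<le> (\<Sum>\<alpha>\<in>A. u k \<alpha>)" for k
  proof -
    have "signomial A c (x k) + b * exp (\<beta> \<bullet> x k) = ((\<Sum>\<alpha>\<in>A. u k \<alpha>) + b) * exp (\<beta> \<bullet> x k)"
      by (simp add: u_def signomial_def distrib_right sum_distrib_right mult.assoc
          exp_add[symmetric] inner_diff_left)
    then have "0 \<le> (\<Sum>\<alpha>\<in>A. u k \<alpha>) + b"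
      using nonneg[of "x k"] by (simp add: zero_le_mult_iff)
    then show ?thesis
      by simp
  qed
  have "\<bar>u k \<alpha>\<bar> \<le> M" if "\<alpha> \<in> A" for k \<alpha>
  proof -
    have "u k \<alpha> \<le> (\<Sum>\<alpha>\<in>A. u k \<alpha>)"
      using assms(1) u0 that by (intro member_le_sum) auto
    moreover have "0 \<le> \<epsilon> k * (x k \<bullet> x k)"
      using \<epsilon>[of k] by simp
    ultimately show ?thesis
      using bound[of k] u0[OF that, of k] by (simp add: u_def)
  qed
  then obtain r \<nu> where r: "strict_mono r"
    and lim: "\<And>\<alpha>. \<alpha> \<in> A \<Longrightarrow> (\<lambda>k. u (r k) \<alpha>) \<longlonglongrightarrow> \<nu> \<alpha>"
    using convergent_coordinates_subseq[OF assms(1), of u M] by metis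
  have \<nu>0: "0 \<le> \<nu> \<alpha>" if "\<alpha> \<in> A" for \<alpha>
    using u0[OF that] by (intro LIMSEQ_le_const[OF lim[OF that]]) auto
  \<comment> \<open>The points \<open>x k\<close> may be unbounded, but
    \<open>\<epsilon> k * (x k \<bullet> x k)\<close> is at most \<open>M\<close>; one more factor
    \<open>\<epsilon> k\<close> sends the squared norm of \<open>\<epsilon> k *\<^sub>R x k\<close>
    to 0.\<close>
  have \<epsilon>x_lim: "(\<lambda>k. \<epsilon> k *\<^sub>R x k) \<longlonglongrightarrow> 0"
  proof (rule Lim_null_comparison)
    show "(\<lambda>k. sqrt (\<epsilon> k * M)) \<longlonglongrightarrow> 0"
      using tendsto_real_sqrt[OF tendsto_mult_left_zero[OF \<epsilon>_lim, of M]] by simp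
    have "norm (\<epsilon> k *\<^sub>R x k) \<le> sqrt (\<epsilon> k * M)" for k
    proof (rule real_le_rsqrt)
      have "0 \<le> (\<Sum>\<alpha>\<in>A. u k \<alpha>)"
        using u0 by (simp add: sum_nonneg)
      then have "\<epsilon> k * (x k \<bullet> x k) \<le> M"
        using bound[of k] by (simp add: u_def)
      then have "\<epsilon> k * (\<epsilon> k * (x k \<bullet> x k)) \<le> \<epsilon> k * M"
        using \<epsilon>[of k] by simp
      then show "(norm (\<epsilon> k *\<^sub>R x k))\<^sup>2 \<le> \<epsilon> k * M"
        unfolding power2_norm_eq_inner by simp
    qed
    then show "\<forall>\<^sub>F k in sequentially. norm (\<epsilon> k *\<^sub>R x k) \<le> sqrt (\<epsilon> k * M)"
      by simp
  qed
  have sum_u_w: "(\<Sum>\<alpha>\<in>A. u k \<alpha> *\<^sub>R (\<alpha> - \<beta>)) = - (2 *\<^sub>R (\<epsilon> k *\<^sub>R x k))" for k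
    using stat[of k] by (simp add: u_def eq_neg_iff_add_eq_0)
  have "(\<lambda>k. \<Sum>\<alpha>\<in>A. u (r k) \<alpha> *\<^sub>R (\<alpha> - \<beta>)) \<longlonglongrightarrow> (\<Sum>\<alpha>\<in>A. \<nu> \<alpha> *\<^sub>R (\<alpha> - \<beta>))"
    by (intro tendsto_intros lim)
  moreover have "(\<lambda>k. - (2 *\<^sub>R (\<epsilon> k *\<^sub>R x k))) \<longlonglongrightarrow> - (2 *\<^sub>R 0)"
    by (intro tendsto_intros \<epsilon>x_lim)
  then have "(\<lambda>k. \<Sum>\<alpha>\<in>A. u (r k) \<alpha> *\<^sub>R (\<alpha> - \<beta>)) \<longlonglongrightarrow> 0"
    using LIMSEQ_subseq_LIMSEQ[where f = r and X = "\<lambda>k. - (2 *\<^sub>R (\<epsilon> k *\<^sub>R x k))"] r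
    by (simp add: sum_u_w o_def)
  ultimately have bal: "(\<Sum>\<alpha>\<in>A. \<nu> \<alpha> *\<^sub>R (\<alpha> - \<beta>)) = 0"
    by (rule LIMSEQ_unique)
  have supp: "\<nu> \<alpha> = 0" if "\<alpha> \<in> A" "c \<alpha> = 0" for \<alpha>
    using lim[OF that(1)] that(2) by (simp add: u_def LIMSEQ_const_iff)
  \<comment> \<open>By the choice of \<open>u\<close>,
    \<open>ln (u k \<alpha>) - ln (c \<alpha>)\<close> is the exponent
    \<open>(\<alpha> - \<beta>) \<bullet> x k\<close>. By stationarity the entropy sum is therefore
    minus the sum of the \<open>u k \<alpha>\<close> minus
    \<open>2 * \<epsilon> k * (x k \<bullet> x k)\<close>. The defect in the balance condition thus
    has the favourable sign.\<close>
  have ent_u: "(\<Sum>\<alpha>\<in>A. u k \<alpha> * ln (u k \<alpha>) - u k \<alpha> * (1 + ln (c \<alpha>))) \<le> b" for k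
  proof -
    have "u k \<alpha> * ln (u k \<alpha>) - u k \<alpha> * (1 + ln (c \<alpha>)) = (u k \<alpha> *\<^sub>R (\<alpha> - \<beta>)) \<bullet> x k - u k \<alpha>"
      if "\<alpha> \<in> A" for \<alpha>
    proof (cases "c \<alpha> = 0")
      case False
      then show ?thesis
        using c[OF that] by (simp add: u_def ln_mult algebra_simps)
    qed (simp add: u_def)
    then have "(\<Sum>\<alpha>\<in>A. u k \<alpha> * ln (u k \<alpha>) - u k \<alpha> * (1 + ln (c \<alpha>)))
        = (\<Sum>\<alpha>\<in>A. u k \<alpha> *\<^sub>R (\<alpha> - \<beta>)) \<bullet> x k - (\<Sum>\<alpha>\<in>A. u k \<alpha>)"
      by (simp add: sum_subtractf inner_sum_left)
    also have "\<dots> \<le> b"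
      using sum_u[of k] mult_nonneg_nonneg[OF less_imp_le[OF \<epsilon>[of k]] inner_ge_zero[of "x k"]]
      by (simp add: sum_u_w)
    finally show ?thesis .
  qed
  have "(\<lambda>k. u (r k) \<alpha> * ln (u (r k) \<alpha>)) \<longlonglongrightarrow> \<nu> \<alpha> * ln (\<nu> \<alpha>)" if "\<alpha> \<in> A" for \<alpha>
  proof (cases "c \<alpha> = 0")
    case True
    then show ?thesis
      using supp[OF that] by (simp add: u_def)
  next
    case False
    then show ?thesis
      using c[OF that] by (intro tendsto_mult_ln lim that) (simp add: u_def)
  qed
  then have "(\<lambda>k. \<Sum>\<alpha>\<in>A. u (r k) \<alpha> * ln (u (r k) \<alpha>) - u (r k) \<alpha> * (1 + ln (c \<alpha>)))
      \<longlonglongrightarrow> (\<Sum>\<alpha>\<in>A. \<nu> \<alpha> * ln (\<nu> \<alpha>) - \<nu> \<alpha> * (1 + ln (c \<alpha>)))"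
    by (intro tendsto_sum tendsto_diff tendsto_mult_right lim)
  then have "(\<Sum>\<alpha>\<in>A. \<nu> \<alpha> * ln (\<nu> \<alpha>) - \<nu> \<alpha> * (1 + ln (c \<alpha>))) \<le> b"
    using ent_u by (intro LIMSEQ_le_const2) auto
  then have "rel_entropy A \<nu> (\<lambda>\<alpha>. exp 1 * c \<alpha>) \<le> ereal b"
    using supp by (subst rel_entropy_le_iff[OF assms(1) c \<nu>0]) auto
  then show ?thesis
    using \<nu>0 bal by blast
qed

section \<open>Normal form of SAGE decompositions\<close>

text \<open>Read \<open>p\<close> as a matrix with a row for each summand. To clear column \<delta>,
  row \<delta> is distributed in nonnegative shares: row \<beta> receives
  \<open>q \<beta> \<delta> / d\<close>, which cancels its entry at \<delta>, and row \<delta> keeps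
  \<open>- c \<delta> / d\<close>. The shares add up to 1, so all column sums persist. Columns
  cleared earlier stay clear because row \<delta> vanishes there as well.\<close>

lemma eliminate_negative_terms:
  fixes p :: "real^'n \<Rightarrow> real^'n \<Rightarrow> real"
  assumes "finite B" and "B \<subseteq> U" and neg: "\<And>\<beta>. \<beta> \<in> B \<Longrightarrow> c \<beta> < 0"
    and "finite S" and "S \<subseteq> B"
    and "\<And>\<beta> x. \<beta> \<in> B \<Longrightarrow> 0 \<le> signomial U (p \<beta>) x"
    and "\<And>\<beta> \<gamma>. \<beta> \<in> B \<Longrightarrow> \<gamma> \<in> U \<Longrightarrow> \<gamma> \<noteq> \<beta> \<Longrightarrow> 0 \<le> p \<beta> \<gamma>"
    and "\<And>\<gamma>. \<gamma> \<in> U \<Longrightarrow> (\<Sum>\<beta>\<in>B. p \<beta> \<gamma>) = c \<gamma>"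
  shows "\<exists>q. (\<forall>\<beta>\<in>B. \<forall>x. 0 \<le> signomial U (q \<beta>) x) \<and>
    (\<forall>\<beta>\<in>B. \<forall>\<gamma>\<in>U. \<gamma> \<noteq> \<beta> \<longrightarrow> 0 \<le> q \<beta> \<gamma>) \<and>
    (\<forall>\<gamma>\<in>U. (\<Sum>\<beta>\<in>B. q \<beta> \<gamma>) = c \<gamma>) \<and>
    (\<forall>\<beta>\<in>B. \<forall>\<gamma>\<in>S. \<gamma> \<noteq> \<beta> \<longrightarrow> q \<beta> \<gamma> = 0)"
  using assms(4,5)
proof (induction S rule: finite_induct)
  case empty
  show ?case
    using assms(6-8) by (intro exI[of _ p]) simp
next
  case (insert \<delta> S)
  then have "S \<subseteq> B" and \<delta>: "\<delta> \<in> B" "\<delta> \<in> U"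
    using assms(2) by auto
  obtain q where nonneg: "\<And>\<beta> x. \<beta> \<in> B \<Longrightarrow> 0 \<le> signomial U (q \<beta>) x"
    and off: "\<And>\<beta> \<gamma>. \<beta> \<in> B \<Longrightarrow> \<gamma> \<in> U \<Longrightarrow> \<gamma> \<noteq> \<beta> \<Longrightarrow> 0 \<le> q \<beta> \<gamma>"
    and total: "\<And>\<gamma>. \<gamma> \<in> U \<Longrightarrow> (\<Sum>\<beta>\<in>B. q \<beta> \<gamma>) = c \<gamma>"
    and clean: "\<And>\<beta> \<gamma>. \<beta> \<in> B \<Longrightarrow> \<gamma> \<in> S \<Longrightarrow> \<gamma> \<noteq> \<beta> \<Longrightarrow> q \<beta> \<gamma> = 0"
    using insert.IH[OF \<open>S \<subseteq> B\<close>] by blast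
  define d where "d = - q \<delta> \<delta>"
  have split: "(\<Sum>\<beta>\<in>B. h \<beta>) = h \<delta> + (\<Sum>\<beta>\<in>B - {\<delta>}. h \<beta>)" for h :: "real^'n \<Rightarrow> real"
    using assms(1) \<delta>(1) by (rule sum.remove)
  \<comment> \<open>The off-diagonal entries of column \<delta> are nonnegative and the column sum
    \<open>c \<delta>\<close> is negative, so the pivot \<open>q \<delta> \<delta> = - d\<close> is
    strictly negative.\<close>
  have "0 \<le> (\<Sum>\<beta>\<in>B - {\<delta>}. q \<beta> \<delta>)"
    using off[OF _ \<delta>(2)] by (intro sum_nonneg) blast
  then have d: "0 < d" and sum_d: "(\<Sum>\<beta>\<in>B - {\<delta>}. q \<beta> \<delta>) = c \<delta> + d"
    using total[OF \<delta>(2)] neg[OF \<delta>(1)] split[of "\<lambda>\<beta>. q \<beta> \<delta>"] by (auto simp: d_def)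
  define q' where "q' = (\<lambda>\<beta> \<gamma>. if \<beta> = \<delta> then - c \<delta> / d * q \<delta> \<gamma>
    else q \<beta> \<gamma> + q \<beta> \<delta> / d * q \<delta> \<gamma>)"
  have r: "0 \<le> q \<beta> \<delta> / d" if "\<beta> \<in> B" "\<beta> \<noteq> \<delta>" for \<beta>
    using off[OF that(1) \<delta>(2)] that(2) d by simp
  have s: "0 \<le> - c \<delta> / d"
    using neg[OF \<delta>(1)] d by (simp add: divide_nonpos_pos)
  have "0 \<le> signomial U (q' \<beta>) x" if "\<beta> \<in> B" for \<beta> x
  proof (cases "\<beta> = \<delta>")
    case True
    then have "signomial U (q' \<beta>) x = - c \<delta> / d * signomial U (q \<delta>) x"
      by (simp add: q'_def signomial_def sum_distrib_left mult.assoc)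
    then show ?thesis
      using mult_nonneg_nonneg[OF s nonneg[OF \<delta>(1)]] by metis
  next
    case False
    then have "signomial U (q' \<beta>) x = signomial U (q \<beta>) x + q \<beta> \<delta> / d * signomial U (q \<delta>) x"
      by (simp add: q'_def signomial_def sum_distrib_left sum.distrib distrib_right mult.assoc)
    then show ?thesis
      using mult_nonneg_nonneg[OF r[OF that False] nonneg[OF \<delta>(1)]] nonneg[OF that]
      by (metis add_nonneg_nonneg)
  qed
  moreover have "0 \<le> q' \<beta> \<gamma>" if "\<beta> \<in> B" "\<gamma> \<in> U" "\<gamma> \<noteq> \<beta>" for \<beta> \<gamma>
  proof (cases "\<beta> = \<delta>")
    case True
    then show ?thesis
      using mult_nonneg_nonneg[OF s off[OF \<delta>(1) that(2)]] that(3) by (simp add: q'_def)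
  next
    case False
    show ?thesis
    proof (cases "\<gamma> = \<delta>")
      case True
      then show ?thesis
        using False d by (simp add: q'_def d_def)
    next
      case \<gamma>: False
      show ?thesis
        using off[OF that] mult_nonneg_nonneg[OF r[OF that(1) False] off[OF \<delta>(1) that(2) \<gamma>]] False
        by (simp add: q'_def)
    qed
  qed
  moreover have "(\<Sum>\<beta>\<in>B. q' \<beta> \<gamma>) = c \<gamma>" if "\<gamma> \<in> U" for \<gamma>
  proof -
    have "(\<Sum>\<beta>\<in>B. q' \<beta> \<gamma>) = - c \<delta> / d * q \<delta> \<gamma> + (\<Sum>\<beta>\<in>B - {\<delta>}. q \<beta> \<gamma> + q \<beta> \<delta> / d * q \<delta> \<gamma>)"
      unfolding split by (simp add: q'_def)
    also have "(\<Sum>\<beta>\<in>B - {\<delta>}. q \<beta> \<gamma> + q \<beta> \<delta> / d * q \<delta> \<gamma>)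
        = (\<Sum>\<beta>\<in>B - {\<delta>}. q \<beta> \<gamma>) + (c \<delta> + d) / d * q \<delta> \<gamma>"
      by (simp add: sum.distrib sum_distrib_right[symmetric] sum_divide_distrib[symmetric] sum_d)
    also have "- c \<delta> / d * q \<delta> \<gamma> + \<dots> = q \<delta> \<gamma> + (\<Sum>\<beta>\<in>B - {\<delta>}. q \<beta> \<gamma>)"
      using d by (simp add: field_simps)
    also have "\<dots> = c \<gamma>"
      using total[OF that] split by simp
    finally show ?thesis .
  qed
  moreover have "q' \<beta> \<gamma> = 0" if "\<beta> \<in> B" "\<gamma> \<in> insert \<delta> S" "\<gamma> \<noteq> \<beta>" for \<beta> \<gamma>
  proof (cases "\<gamma> = \<delta>")
    case True
    then show ?thesis
      using that(3) d by (simp add: q'_def d_def)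
  next
    case False
    then show ?thesis
      using that clean[OF \<delta>(1), of \<gamma>] clean[OF that(1), of \<gamma>] by (simp add: q'_def)
  qed
  ultimately show ?case
    by blast
qed

lemma sum_fun_apply: "(\<Sum>i\<in>I. s i) x = (\<Sum>i\<in>I. s i x)" for s :: "'i \<Rightarrow> 'a \<Rightarrow> 'b::comm_monoid_add"
  by (induction I rule: infinite_finite_induct) (simp_all add: zero_fun_def plus_fun_def)

text \<open>By definition the summand for \<beta> may have positive coefficients at other elements
  of B. Once these are eliminated, column \<beta> has only its diagonal entry left, which must then
  equal \<open>c \<beta>\<close>. This leaves one coefficient vector on A for each \<beta> as the
  only freedom.\<close>

lemma C_SAGE_iff:
  fixes c :: "real^'n \<Rightarrow> real"
  assumes "finite A" and "finite B" and "A \<inter> B = {}" and neg: "\<And>\<beta>. \<beta> \<in> B \<Longrightarrow> c \<beta> < 0"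
  shows "(\<lambda>x. signomial A c x + signomial B c x) \<in> C_SAGE A B \<longleftrightarrow>
    (\<exists>p. (\<forall>\<beta>\<in>B. \<forall>\<alpha>\<in>A. 0 \<le> p \<beta> \<alpha>) \<and>
         (\<forall>\<beta>\<in>B. \<forall>x. 0 \<le> signomial A (p \<beta>) x + c \<beta> * exp (\<beta> \<bullet> x)) \<and>
         (\<forall>\<alpha>\<in>A. (\<Sum>\<beta>\<in>B. p \<beta> \<alpha>) = c \<alpha>))"
    (is "?f \<in> _ \<longleftrightarrow> ?rhs")
proof
  assume "?f \<in> C_SAGE A B"
  then obtain s where s: "\<forall>\<beta>\<in>B. s \<beta> \<in> C_AGE (A \<union> B - {\<beta>}) \<beta>" and f: "?f = sum s B"
    unfolding C_SAGE_def set_sum_alt[OF assms(2)] by blast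
  define U where "U = A \<union> B"
  have U: "finite U" "B \<subseteq> U"
    using assms by (auto simp: U_def)
  \<comment> \<open>All summands are written over the same exponent set \<open>U\<close>, so that
    they form a matrix; the free coefficient \<open>b\<close> of the summand becomes the diagonal
    entry.\<close>
  have "\<forall>\<beta>\<in>B. \<exists>k. (\<forall>\<gamma>\<in>U. \<gamma> \<noteq> \<beta> \<longrightarrow> 0 \<le> k \<gamma>) \<and> s \<beta> = signomial U k \<and> (\<forall>x. 0 \<le> signomial U k x)"
  proof
    fix \<beta> assume \<beta>: "\<beta> \<in> B"
    then obtain k b where k: "\<forall>\<alpha>\<in>U - {\<beta>}. 0 \<le> k \<alpha>" "\<forall>x. 0 \<le> s \<beta> x"
      and s\<beta>: "s \<beta> = (\<lambda>x. signomial (U - {\<beta>}) k x + b * exp (\<beta> \<bullet> x))"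
      using s unfolding C_AGE_def U_def by blast
    have "signomial U (k(\<beta> := b)) = s \<beta>"
    proof
      fix x
      have "signomial U (k(\<beta> := b)) x
          = b * exp (\<beta> \<bullet> x) + (\<Sum>\<alpha>\<in>U - {\<beta>}. (k(\<beta> := b)) \<alpha> * exp (\<alpha> \<bullet> x))"
        unfolding signomial_def using U \<beta> by (subst sum.remove[of U \<beta>]) auto
      also have "\<dots> = s \<beta> x"
        by (simp add: s\<beta> signomial_def)
      finally show "signomial U (k(\<beta> := b)) x = s \<beta> x" .
    qed
    then show "\<exists>k. (\<forall>\<gamma>\<in>U. \<gamma> \<noteq> \<beta> \<longrightarrow> 0 \<le> k \<gamma>) \<and> s \<beta> = signomial U k \<and> (\<forall>x. 0 \<le> signomial U k x)"
      using k by (intro exI[of _ "k(\<beta> := b)"]) simp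
  qed
  from bchoice[OF this] obtain p
    where off: "\<And>\<beta> \<gamma>. \<beta> \<in> B \<Longrightarrow> \<gamma> \<in> U \<Longrightarrow> \<gamma> \<noteq> \<beta> \<Longrightarrow> 0 \<le> p \<beta> \<gamma>"
      and sp: "\<And>\<beta>. \<beta> \<in> B \<Longrightarrow> s \<beta> = signomial U (p \<beta>)"
      and nonneg: "\<And>\<beta> x. \<beta> \<in> B \<Longrightarrow> 0 \<le> signomial U (p \<beta>) x"
    by blast
  have f_U: "?f x = signomial U c x" for x
    using assms by (simp add: U_def signomial_def sum.union_disjoint)
  have f_p: "?f x = signomial U (\<lambda>\<gamma>. \<Sum>\<beta>\<in>B. p \<beta> \<gamma>) x" for x
  proof -
    have "?f x = (\<Sum>\<beta>\<in>B. signomial U (p \<beta>) x)"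
      using fun_cong[OF f, of x] by (simp add: sum_fun_apply sp)
    also have "\<dots> = signomial U (\<lambda>\<gamma>. \<Sum>\<beta>\<in>B. p \<beta> \<gamma>) x"
      unfolding signomial_def sum_distrib_right by (rule sum.swap)
    finally show ?thesis .
  qed
  \<comment> \<open>Linear independence of exponentials: equality of the two functions gives
    equality in each exponent.\<close>
  have total: "(\<Sum>\<beta>\<in>B. p \<beta> \<gamma>) = c \<gamma>" if "\<gamma> \<in> U" for \<gamma>
    by (rule signomial_eqD[OF U(1) _ that]) (use f_U f_p in auto)
  obtain q where q_nonneg: "\<And>\<beta> x. \<beta> \<in> B \<Longrightarrow> 0 \<le> signomial U (q \<beta>) x"
    and q_off: "\<And>\<beta> \<gamma>. \<beta> \<in> B \<Longrightarrow> \<gamma> \<in> U \<Longrightarrow> \<gamma> \<noteq> \<beta> \<Longrightarrow> 0 \<le> q \<beta> \<gamma>"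
    and q_total: "\<And>\<gamma>. \<gamma> \<in> U \<Longrightarrow> (\<Sum>\<beta>\<in>B. q \<beta> \<gamma>) = c \<gamma>"
    and q_clean: "\<And>\<beta> \<gamma>. \<beta> \<in> B \<Longrightarrow> \<gamma> \<in> B \<Longrightarrow> \<gamma> \<noteq> \<beta> \<Longrightarrow> q \<beta> \<gamma> = 0"
    using eliminate_negative_terms[of B U c B p, OF assms(2) U(2) neg assms(2) subset_refl nonneg off total]
    by blast
  have diag: "q \<beta> \<beta> = c \<beta>" if "\<beta> \<in> B" for \<beta>
  proof -
    have "(\<Sum>\<beta>'\<in>B. q \<beta>' \<beta>) = q \<beta> \<beta> + (\<Sum>\<beta>'\<in>B - {\<beta>}. q \<beta>' \<beta>)"
      using assms(2) that by (rule sum.remove)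
    also have "(\<Sum>\<beta>'\<in>B - {\<beta>}. q \<beta>' \<beta>) = 0"
      using q_clean that by (intro sum.neutral) auto
    finally show ?thesis
      using q_total[of \<beta>] that U by auto
  qed
  have "signomial A (q \<beta>) x + c \<beta> * exp (\<beta> \<bullet> x) = signomial U (q \<beta>) x" if "\<beta> \<in> B" for \<beta> x
  proof -
    have "signomial U (q \<beta>) x = signomial A (q \<beta>) x + (\<Sum>\<gamma>\<in>B. q \<beta> \<gamma> * exp (\<gamma> \<bullet> x))"
      unfolding U_def signomial_def using assms by (simp add: sum.union_disjoint)
    also have "(\<Sum>\<gamma>\<in>B. q \<beta> \<gamma> * exp (\<gamma> \<bullet> x)) = q \<beta> \<beta> * exp (\<beta> \<bullet> x) + (\<Sum>\<gamma>\<in>B - {\<beta>}. q \<beta> \<gamma> * exp (\<gamma> \<bullet> x))"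
      using assms(2) that by (rule sum.remove)
    also have "(\<Sum>\<gamma>\<in>B - {\<beta>}. q \<beta> \<gamma> * exp (\<gamma> \<bullet> x)) = 0"
      using q_clean that by (intro sum.neutral) auto
    finally show ?thesis
      using diag[OF that] by simp
  qed
  moreover have "0 \<le> q \<beta> \<alpha>" if "\<beta> \<in> B" "\<alpha> \<in> A" for \<beta> \<alpha>
    using that assms(3) by (intro q_off) (auto simp: U_def)
  ultimately show ?rhs
    using q_nonneg q_total unfolding U_def by (intro exI[of _ q]) simp
next
  assume ?rhs
  then obtain p where p0: "\<And>\<beta> \<alpha>. \<beta> \<in> B \<Longrightarrow> \<alpha> \<in> A \<Longrightarrow> 0 \<le> p \<beta> \<alpha>"
    and nonneg: "\<And>\<beta> x. \<beta> \<in> B \<Longrightarrow> 0 \<le> signomial A (p \<beta>) x + c \<beta> * exp (\<beta> \<bullet> x)"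
    and total: "\<And>\<alpha>. \<alpha> \<in> A \<Longrightarrow> (\<Sum>\<beta>\<in>B. p \<beta> \<alpha>) = c \<alpha>"
    by blast
  define s where "s = (\<lambda>\<beta> x. signomial A (p \<beta>) x + c \<beta> * exp (\<beta> \<bullet> x))"
  have "s \<beta> \<in> C_AGE (A \<union> B - {\<beta>}) \<beta>" if "\<beta> \<in> B" for \<beta>
  proof -
    have "signomial (A \<union> B - {\<beta>}) (\<lambda>\<alpha>. if \<alpha> \<in> A then p \<beta> \<alpha> else 0) = signomial A (p \<beta>)"
      unfolding signomial_def using assms that
      by (intro ext sum.mono_neutral_cong_right) auto
    moreover have "0 \<le> (if \<alpha> \<in> A then p \<beta> \<alpha> else 0)" for \<alpha>
      using p0[OF that] by simp
    ultimately show ?thesis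
      unfolding C_AGE_def s_def using nonneg[OF that]
      by (intro CollectI exI[of _ "\<lambda>\<alpha>. if \<alpha> \<in> A then p \<beta> \<alpha> else 0"] exI[of _ "c \<beta>"])
        (simp only: simp_thms, simp)
  qed
  moreover have "?f = sum s B"
  proof
    fix x
    have "sum s B x = (\<Sum>\<beta>\<in>B. signomial A (p \<beta>) x) + signomial B c x"
      by (simp add: sum_fun_apply s_def sum.distrib signomial_def[of B])
    also have "(\<Sum>\<beta>\<in>B. signomial A (p \<beta>) x) = (\<Sum>\<alpha>\<in>A. \<Sum>\<beta>\<in>B. p \<beta> \<alpha> * exp (\<alpha> \<bullet> x))"
      unfolding signomial_def by (rule sum.swap)
    also have "\<dots> = signomial A c x"
      by (simp add: signomial_def sum_distrib_right[symmetric] total)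
    finally show "?f x = sum s B x" ..
  qed
  ultimately show "?f \<in> C_SAGE A B"
    unfolding C_SAGE_def set_sum_alt[OF assms(2)] by (intro CollectI exI[of _ s]) simp
qed

section \<open>The dual action and averages over groups\<close>

text \<open>Jensen's inequality, by summing the tangent inequalities at the mean. A mean of 0 is
  treated apart because there is no tangent at 0; all values are then 0.\<close>

lemma entropy_mean_le:
  fixes t :: "'i \<Rightarrow> real"
  assumes "finite I" and "I \<noteq> {}" and t: "\<And>i. i \<in> I \<Longrightarrow> 0 \<le> t i"
  defines "s \<equiv> (\<Sum>i\<in>I. t i) / card I"
  shows "s * ln s \<le> (\<Sum>i\<in>I. t i * ln (t i)) / card I"
proof (cases "s = 0")
  case True
  then have "\<forall>i\<in>I. t i = 0"
    using assms by (simp add: s_def sum_nonneg_eq_0_iff)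
  then show ?thesis
    using True by simp
next
  case False
  have sum_t: "(\<Sum>i\<in>I. t i) = card I * s"
    using assms by (simp add: s_def)
  have "0 \<le> s"
    by (simp add: s_def sum_nonneg t)
  then have "0 < s"
    using False by simp
  have "(\<Sum>i\<in>I. t i * ln s + t i - s) \<le> (\<Sum>i\<in>I. t i * ln (t i))"
    by (intro sum_mono entropy_tangent \<open>0 < s\<close> t)
  moreover have "(\<Sum>i\<in>I. t i * ln s + t i - s) = card I * (s * ln s)"
    by (simp add: sum.distrib sum_subtractf sum_distrib_right[symmetric] sum_t)
  moreover have "0 < card I"
    using assms by (simp add: card_gt_0_iff)
  ultimately show ?thesis
    by (simp add: field_simps)
qed

locale linear_group_action = group G for G (structure) +
  fixes \<phi> :: "'a \<Rightarrow> real^'n^'n"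
  assumes finite_carrier: "finite (carrier G)"
    and hom: "\<phi> \<in> hom G GL"
begin

abbreviation act :: "'a \<Rightarrow> real^'n \<Rightarrow> real^'n" where
  "act \<equiv> dual_action G \<phi>"

abbreviation stab :: "real^'n \<Rightarrow> 'a set" where
  "stab \<equiv> stabilizer G act"

lemma hom_matrix_mult:
  "\<sigma> \<in> carrier G \<Longrightarrow> \<tau> \<in> carrier G \<Longrightarrow> \<phi> (\<sigma> \<otimes> \<tau>) = \<phi> \<sigma> ** \<phi> \<tau>"
  using hom_mult[OF hom] by (simp add: GL_def)

text \<open>Membership in \<open>hom\<close> only asserts compatibility with products; the image of
  the unit is an idempotent invertible matrix, hence the identity.\<close>

lemma hom_matrix_one: "\<phi> \<one> = mat 1"
proof -
  have "invertible (\<phi> \<one>)"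
    using hom_in_carrier[OF hom one_closed] by (simp add: GL_def)
  then obtain M where M: "M ** \<phi> \<one> = mat 1"
    by (auto simp: invertible_def)
  have "\<phi> \<one> ** \<phi> \<one> = \<phi> \<one>"
    using hom_matrix_mult[of \<one> \<one>] by simp
  then have "(M ** \<phi> \<one>) ** \<phi> \<one> = M ** \<phi> \<one>"
    by (simp add: matrix_mul_assoc[symmetric])
  then show ?thesis
    by (simp add: M)
qed

lemma inner_act: "act \<sigma> \<alpha> \<bullet> x = \<alpha> \<bullet> (\<phi> (inv \<sigma>) *v x)"
  using adjoint_works[OF matrix_vector_mul_linear[of "\<phi> (inv \<sigma>)"], of x \<alpha>]
  by (simp add: dual_action_def inner_commute)

lemma linear_act: "linear (act \<sigma>)"
  unfolding dual_action_def by (intro adjoint_linear matrix_vector_mul_linear)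

text \<open>Inversion and taking adjoints both reverse products, so together they keep the order and
  yield a left action. The identity is tested by pairing with every x.\<close>

lemma act_mult:
  assumes "\<sigma> \<in> carrier G" "\<tau> \<in> carrier G"
  shows "act (\<sigma> \<otimes> \<tau>) \<alpha> = act \<sigma> (act \<tau> \<alpha>)"
proof -
  have "act (\<sigma> \<otimes> \<tau>) \<alpha> \<bullet> x = act \<sigma> (act \<tau> \<alpha>) \<bullet> x" for x
    using assms by (simp add: inner_act inv_mult_group hom_matrix_mult matrix_vector_mul_assoc)
  then show ?thesis
    using vector_eq_rdot by blast
qed

lemma act_one [simp]: "act \<one> \<alpha> = \<alpha>"
proof -
  have "act \<one> \<alpha> \<bullet> x = \<alpha> \<bullet> x" for x
    by (simp add: inner_act hom_matrix_one)
  then show ?thesis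
    using vector_eq_rdot by blast
qed

lemma act_inv_act [simp]: "\<sigma> \<in> carrier G \<Longrightarrow> act (inv \<sigma>) (act \<sigma> \<alpha>) = \<alpha>"
  by (simp add: act_mult[symmetric])

lemma act_act_inv [simp]: "\<sigma> \<in> carrier G \<Longrightarrow> act \<sigma> (act (inv \<sigma>) \<alpha>) = \<alpha>"
  by (simp add: act_mult[symmetric])

lemma bij_betw_act:
  assumes "\<sigma> \<in> carrier G" and "\<And>\<tau> \<alpha>. \<tau> \<in> carrier G \<Longrightarrow> \<alpha> \<in> S \<Longrightarrow> act \<tau> \<alpha> \<in> S"
  shows "bij_betw (act \<sigma>) S S"
  using assms by (intro bij_betwI[where g = "act (inv \<sigma>)"]) auto

lemma sum_act:
  assumes "\<sigma> \<in> carrier G" and "\<And>\<tau> \<alpha>. \<tau> \<in> carrier G \<Longrightarrow> \<alpha> \<in> S \<Longrightarrow> act \<tau> \<alpha> \<in> S"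
  shows "(\<Sum>\<alpha>\<in>S. h (act \<sigma> \<alpha>)) = (\<Sum>\<alpha>\<in>S. h \<alpha>)"
  using bij_betw_act[OF assms] by (rule sum.reindex_bij_betw)

lemma sum_translate:
  assumes H: "subgroup H G" and \<tau>: "\<tau> \<in> H"
  shows "(\<Sum>\<sigma>\<in>H. h (\<sigma> \<otimes> \<tau>)) = (\<Sum>\<sigma>\<in>H. h \<sigma>)"
proof (rule sum.reindex_bij_betw)
  show "bij_betw (\<lambda>\<sigma>. \<sigma> \<otimes> \<tau>) H H"
    using subgroup.mem_carrier[OF H] subgroup.m_closed[OF H] subgroup.m_inv_closed[OF H] \<tau>
    by (intro bij_betwI[where g = "\<lambda>\<sigma>. \<sigma> \<otimes> inv \<tau>"]) (auto simp: m_assoc)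
qed

lemma subgroup_stab: "subgroup (stab \<beta>) G"
proof (rule subgroupI)
  show "inv \<sigma> \<in> stab \<beta>" if "\<sigma> \<in> stab \<beta>" for \<sigma>
    using that act_inv_act[of \<sigma> \<beta>] by (simp add: stabilizer_def)
  show "stab \<beta> \<noteq> {}"
    using act_one by (auto simp: stabilizer_def)
qed (auto simp: stabilizer_def act_mult)

lemma inner_act_eq:
  assumes "\<sigma> \<in> carrier G"
  shows "act \<sigma> \<alpha> \<bullet> (\<phi> \<sigma> *v x) = \<alpha> \<bullet> x"
  using assms
  by (simp add: inner_act matrix_vector_mul_assoc hom_matrix_mult[symmetric] hom_matrix_one)

text \<open>The pairing is invariant when \<sigma> acts on both exponents and variables. The
  function in the conclusion is thus the assumed one after the substitution of
  \<open>\<phi> \<sigma> *v x\<close> for x, with the sum reindexed along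
  \<open>act \<sigma>\<close>.\<close>

lemma age_nonneg_act:
  assumes "\<sigma> \<in> carrier G" and stable: "\<And>\<tau> \<alpha>. \<tau> \<in> carrier G \<Longrightarrow> \<alpha> \<in> S \<Longrightarrow> act \<tau> \<alpha> \<in> S"
    and nonneg: "\<And>x. 0 \<le> signomial S k x + b * exp (act \<sigma> \<beta> \<bullet> x)"
  shows "0 \<le> signomial S (\<lambda>\<alpha>. k (act \<sigma> \<alpha>)) x + b * exp (\<beta> \<bullet> x)"
proof -
  have "signomial S (\<lambda>\<alpha>. k (act \<sigma> \<alpha>)) x
      = (\<Sum>\<alpha>\<in>S. k (act \<sigma> \<alpha>) * exp (act \<sigma> \<alpha> \<bullet> (\<phi> \<sigma> *v x)))"
    by (simp add: signomial_def inner_act_eq[OF assms(1)])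
  also have "\<dots> = signomial S k (\<phi> \<sigma> *v x)"
    unfolding signomial_def by (rule sum_act[OF assms(1) stable])
  finally show ?thesis
    using nonneg[of "\<phi> \<sigma> *v x"] by (simp add: inner_act_eq[OF assms(1)])
qed

text \<open>Acting on f moves the coefficient at \<gamma> to \<open>act \<sigma> \<gamma>\<close>.
  By linear independence that coefficient already stands there in f, and as it is nonzero,
  \<open>act \<sigma> \<gamma>\<close> belongs to \<open>U\<close>.\<close>

lemma signomial_invariant_coefficients:
  assumes "finite U" and nz: "\<And>\<gamma>. \<gamma> \<in> U \<Longrightarrow> c \<gamma> \<noteq> 0"
    and inv: "fun_action G \<phi> \<sigma> (signomial U c) = signomial U c"
    and \<sigma>: "\<sigma> \<in> carrier G" and \<gamma>: "\<gamma> \<in> U"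
  shows "act \<sigma> \<gamma> \<in> U \<and> c (act \<sigma> \<gamma>) = c \<gamma>"
proof -
  \<comment> \<open>Stability of \<open>U\<close> is still to be shown, so coefficients are compared
    on a set that contains both \<open>U\<close> and its image, with \<open>c\<close> extended by
    0.\<close>
  define V where "V = U \<union> act \<sigma> ` U"
  define d where "d = (\<lambda>\<gamma>. if \<gamma> \<in> U then c \<gamma> else 0)"
  have V: "finite V" "U \<subseteq> V" "act \<sigma> ` U \<subseteq> V"
    using assms(1) by (auto simp: V_def)
  have inj: "inj_on (act \<sigma>) U"
    by (rule inj_on_inverseI[where g = "act (inv \<sigma>)"]) (use \<sigma> in simp)
  have "signomial V d x = signomial V (\<lambda>\<gamma>. d (act (inv \<sigma>) \<gamma>)) x" for x
  proof -
    have "signomial V d x = signomial U c x"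
      unfolding signomial_def by (rule sum.mono_neutral_cong_right) (use V in \<open>auto simp: d_def\<close>)
    also have "\<dots> = fun_action G \<phi> \<sigma> (signomial U c) x"
      by (simp add: inv)
    also have "\<dots> = (\<Sum>\<gamma>\<in>U. d (act (inv \<sigma>) (act \<sigma> \<gamma>)) * exp (act \<sigma> \<gamma> \<bullet> x))"
      by (simp add: fun_action_def signomial_def inner_act \<sigma> d_def)
    also have "\<dots> = (\<Sum>\<gamma>\<in>act \<sigma> ` U. d (act (inv \<sigma>) \<gamma>) * exp (\<gamma> \<bullet> x))"
      by (simp add: sum.reindex[OF inj])
    also have "\<dots> = signomial V (\<lambda>\<gamma>. d (act (inv \<sigma>) \<gamma>)) x"
      unfolding signomial_def
    proof (rule sum.mono_neutral_left[OF V(1,3)])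
      show "\<forall>\<gamma>\<in>V - act \<sigma> ` U. d (act (inv \<sigma>) \<gamma>) * exp (\<gamma> \<bullet> x) = 0"
      proof
        fix \<gamma> assume "\<gamma> \<in> V - act \<sigma> ` U"
        then have "act (inv \<sigma>) \<gamma> \<notin> U"
          using \<sigma> act_act_inv[of \<sigma> \<gamma>] by (metis DiffD2 image_eqI)
        then show "d (act (inv \<sigma>) \<gamma>) * exp (\<gamma> \<bullet> x) = 0"
          by (simp add: d_def)
      qed
    qed
    finally show ?thesis .
  qed
  from signomial_eqD[OF V(1) this, of "act \<sigma> \<gamma>"]
  have "d (act \<sigma> \<gamma>) = c \<gamma>"
    using V \<gamma> \<sigma> by (simp add: d_def image_subset_iff)
  then show ?thesis
    using nz[OF \<gamma>] by (auto simp: d_def split: if_splits)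
qed

text \<open>Translating the summand at \<open>act \<sigma> \<beta>\<close> back to \<beta> gives
  another AGE function with the same coefficient \<open>c \<beta>\<close>, as \<open>c\<close> is
  invariant. The mean over \<sigma> therefore keeps this coefficient and nonnegativity, and for each
  \<sigma> the sum over B is merely permuted.\<close>

lemma average_age_family:
  fixes p :: "real^'n \<Rightarrow> real^'n \<Rightarrow> real"
  assumes A: "\<And>\<sigma> \<alpha>. \<sigma> \<in> carrier G \<Longrightarrow> \<alpha> \<in> A \<Longrightarrow> act \<sigma> \<alpha> \<in> A"
    and B: "\<And>\<sigma> \<beta>. \<sigma> \<in> carrier G \<Longrightarrow> \<beta> \<in> B \<Longrightarrow> act \<sigma> \<beta> \<in> B"
    and c: "\<And>\<sigma> \<gamma>. \<sigma> \<in> carrier G \<Longrightarrow> \<gamma> \<in> A \<union> B \<Longrightarrow> c (act \<sigma> \<gamma>) = c \<gamma>"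
    and p0: "\<And>\<beta> \<alpha>. \<beta> \<in> B \<Longrightarrow> \<alpha> \<in> A \<Longrightarrow> 0 \<le> p \<beta> \<alpha>"
    and nonneg: "\<And>\<beta> x. \<beta> \<in> B \<Longrightarrow> 0 \<le> signomial A (p \<beta>) x + c \<beta> * exp (\<beta> \<bullet> x)"
    and total: "\<And>\<alpha>. \<alpha> \<in> A \<Longrightarrow> (\<Sum>\<beta>\<in>B. p \<beta> \<alpha>) = c \<alpha>"
  shows "\<exists>q. (\<forall>\<beta>\<in>B. \<forall>\<alpha>\<in>A. 0 \<le> q \<beta> \<alpha>) \<and>
    (\<forall>\<beta>\<in>B. \<forall>x. 0 \<le> signomial A (q \<beta>) x + c \<beta> * exp (\<beta> \<bullet> x)) \<and>
    (\<forall>\<alpha>\<in>A. (\<Sum>\<beta>\<in>B. q \<beta> \<alpha>) = c \<alpha>) \<and>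
    (\<forall>\<tau>\<in>carrier G. \<forall>\<beta>\<in>B. \<forall>\<alpha>\<in>A. q (act \<tau> \<beta>) (act \<tau> \<alpha>) = q \<beta> \<alpha>)"
proof -
  define N where "N = real (card (carrier G))"
  have N: "0 < N"
    using finite_carrier one_closed by (auto simp: N_def card_gt_0_iff)
  define q where "q = (\<lambda>\<beta> \<alpha>. (\<Sum>\<sigma>\<in>carrier G. p (act \<sigma> \<beta>) (act \<sigma> \<alpha>)) / N)"
  have "0 \<le> q \<beta> \<alpha>" if "\<beta> \<in> B" "\<alpha> \<in> A" for \<beta> \<alpha>
    unfolding q_def using that N by (intro divide_nonneg_pos sum_nonneg p0 A B)
  moreover have "0 \<le> signomial A (q \<beta>) x + c \<beta> * exp (\<beta> \<bullet> x)" if "\<beta> \<in> B" for \<beta> x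
  proof -
    have "0 \<le> (\<Sum>\<sigma>\<in>carrier G. signomial A (\<lambda>\<alpha>. p (act \<sigma> \<beta>) (act \<sigma> \<alpha>)) x + c \<beta> * exp (\<beta> \<bullet> x)) / N"
    proof (intro divide_nonneg_pos sum_nonneg N)
      fix \<sigma> assume \<sigma>: "\<sigma> \<in> carrier G"
      show "0 \<le> signomial A (\<lambda>\<alpha>. p (act \<sigma> \<beta>) (act \<sigma> \<alpha>)) x + c \<beta> * exp (\<beta> \<bullet> x)"
        using nonneg[OF B[OF \<sigma> that]] c[OF \<sigma>, of \<beta>] that
        by (intro age_nonneg_act[OF \<sigma> A]) auto
    qed
    also have "\<dots> = signomial A (q \<beta>) x + c \<beta> * exp (\<beta> \<bullet> x)"
      using N sum.swap[of "\<lambda>\<sigma> \<alpha>. p (act \<sigma> \<beta>) (act \<sigma> \<alpha>) * exp (\<alpha> \<bullet> x)" A "carrier G"]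
      by (simp add: q_def signomial_def sum.distrib add_divide_distrib N_def[symmetric]
          sum_distrib_right sum_divide_distrib[symmetric])
    finally show ?thesis .
  qed
  moreover have "(\<Sum>\<beta>\<in>B. q \<beta> \<alpha>) = c \<alpha>" if "\<alpha> \<in> A" for \<alpha>
  proof -
    have "(\<Sum>\<beta>\<in>B. q \<beta> \<alpha>) = (\<Sum>\<sigma>\<in>carrier G. \<Sum>\<beta>\<in>B. p (act \<sigma> \<beta>) (act \<sigma> \<alpha>)) / N"
      unfolding q_def sum_divide_distrib[symmetric] by (subst sum.swap) (rule refl)
    also have "(\<Sum>\<sigma>\<in>carrier G. \<Sum>\<beta>\<in>B. p (act \<sigma> \<beta>) (act \<sigma> \<alpha>)) = (\<Sum>\<sigma>\<in>carrier G. c \<alpha>)"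
    proof (rule sum.cong[OF refl])
      fix \<sigma> assume \<sigma>: "\<sigma> \<in> carrier G"
      have "(\<Sum>\<beta>\<in>B. p (act \<sigma> \<beta>) (act \<sigma> \<alpha>)) = (\<Sum>\<beta>\<in>B. p \<beta> (act \<sigma> \<alpha>))"
        by (rule sum_act[OF \<sigma> B])
      then show "(\<Sum>\<beta>\<in>B. p (act \<sigma> \<beta>) (act \<sigma> \<alpha>)) = c \<alpha>"
        using total[OF A[OF \<sigma> that]] c[OF \<sigma>, of \<alpha>] that by simp
    qed
    finally show ?thesis
      using N by (simp add: N_def)
  qed
  \<comment> \<open>Passing from \<sigma> to \<open>\<sigma> \<otimes> \<tau>\<close> only permutes
    the summands of the mean.\<close>
  moreover have "q (act \<tau> \<beta>) (act \<tau> \<alpha>) = q \<beta> \<alpha>" if \<tau>: "\<tau> \<in> carrier G" for \<tau> \<beta> \<alpha>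
    using sum_translate[OF subgroup_self \<tau>, of "\<lambda>\<sigma>. p (act \<sigma> \<beta>) (act \<sigma> \<alpha>)"] \<tau>
    by (simp add: q_def act_mult)
  ultimately show ?thesis
    by (intro exI[of _ q]) simp
qed

text \<open>The coefficients \<open>k\<close> are already invariant, so only \<nu> has to be
  averaged. Each translate of \<nu> by an element that fixes \<beta> is again a certificate for the
  same \<open>k\<close> and \<open>b\<close>, and by convexity so is their mean.\<close>

lemma average_entropy_certificate:
  fixes k \<nu> :: "real^'n \<Rightarrow> real"
  assumes "finite A"
    and A: "\<And>\<sigma> \<alpha>. \<sigma> \<in> carrier G \<Longrightarrow> \<alpha> \<in> A \<Longrightarrow> act \<sigma> \<alpha> \<in> A"
    and k0: "\<And>\<alpha>. \<alpha> \<in> A \<Longrightarrow> 0 \<le> k \<alpha>" and \<nu>0: "\<And>\<alpha>. \<alpha> \<in> A \<Longrightarrow> 0 \<le> \<nu> \<alpha>"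
    and k_inv: "invariant_vector act (stab \<beta>) A k"
    and bal: "(\<Sum>\<alpha>\<in>A. \<nu> \<alpha> *\<^sub>R (\<alpha> - \<beta>)) = 0"
    and ent: "rel_entropy A \<nu> (\<lambda>\<alpha>. exp 1 * k \<alpha>) \<le> ereal b"
  shows "\<exists>\<nu>'. (\<forall>\<alpha>\<in>A. 0 \<le> \<nu>' \<alpha>) \<and> invariant_vector act (stab \<beta>) A \<nu>' \<and>
    (\<Sum>\<alpha>\<in>A. \<nu>' \<alpha> *\<^sub>R (\<alpha> - \<beta>)) = 0 \<and> rel_entropy A \<nu>' (\<lambda>\<alpha>. exp 1 * k \<alpha>) \<le> ereal b"
proof -
  define H where "H = stab \<beta>"
  have H: "subgroup H G"
    unfolding H_def by (rule subgroup_stab)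
  have HG: "\<And>\<sigma>. \<sigma> \<in> H \<Longrightarrow> \<sigma> \<in> carrier G" and H\<beta>: "\<And>\<sigma>. \<sigma> \<in> H \<Longrightarrow> act \<sigma> \<beta> = \<beta>"
    by (auto simp: H_def stabilizer_def)
  have k_inv': "\<And>\<sigma> \<alpha>. \<sigma> \<in> H \<Longrightarrow> \<alpha> \<in> A \<Longrightarrow> k (act \<sigma> \<alpha>) = k \<alpha>"
    using k_inv by (simp add: invariant_vector_def H_def)
  have fin: "finite H" and ne: "H \<noteq> {}"
    using finite_subset[OF subgroup.subset[OF H] finite_carrier] subgroup.one_closed[OF H] by auto
  define N where "N = real (card H)"
  have N: "0 < N"
    using fin ne by (simp add: N_def card_gt_0_iff)
  define \<nu>' where "\<nu>' = (\<lambda>\<alpha>. (\<Sum>\<sigma>\<in>H. \<nu> (act \<sigma> \<alpha>)) / N)"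
  have supp: "\<And>\<alpha>. \<alpha> \<in> A \<Longrightarrow> k \<alpha> = 0 \<Longrightarrow> \<nu> \<alpha> = 0"
    and ent': "(\<Sum>\<alpha>\<in>A. \<nu> \<alpha> * ln (\<nu> \<alpha>) - \<nu> \<alpha> * (1 + ln (k \<alpha>))) \<le> b"
    using ent rel_entropy_le_iff[OF assms(1) k0 \<nu>0] by auto
  have \<nu>'0: "0 \<le> \<nu>' \<alpha>" if "\<alpha> \<in> A" for \<alpha>
    unfolding \<nu>'_def using that N by (intro divide_nonneg_pos sum_nonneg \<nu>0 A HG)
  have inv': "invariant_vector act (stab \<beta>) A \<nu>'"
    unfolding invariant_vector_def
  proof (intro ballI)
    fix \<alpha> \<tau> assume "\<tau> \<in> stab \<beta>"
    then have \<tau>: "\<tau> \<in> H"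
      by (simp add: H_def)
    show "\<nu>' (act \<tau> \<alpha>) = \<nu>' \<alpha>"
      using sum_translate[OF H \<tau>, of "\<lambda>\<sigma>. \<nu> (act \<sigma> \<alpha>)"] HG \<tau> by (simp add: \<nu>'_def act_mult)
  qed
  \<comment> \<open>Since \<sigma> fixes \<beta>, the balance vector of the translate is the image
    of the original one under the linear map \<open>act (inv \<sigma>)\<close>.\<close>
  have bal_\<sigma>: "(\<Sum>\<alpha>\<in>A. \<nu> (act \<sigma> \<alpha>) *\<^sub>R (\<alpha> - \<beta>)) = 0" if \<sigma>: "\<sigma> \<in> H" for \<sigma>
  proof -
    have \<beta>: "act (inv \<sigma>) \<beta> = \<beta>"
      using H\<beta>[OF subgroup.m_inv_closed[OF H \<sigma>]] .
    have "(\<Sum>\<alpha>\<in>A. \<nu> (act \<sigma> \<alpha>) *\<^sub>R (\<alpha> - \<beta>))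
        = (\<Sum>\<alpha>\<in>A. \<nu> (act \<sigma> \<alpha>) *\<^sub>R (act (inv \<sigma>) (act \<sigma> \<alpha>) - \<beta>))"
      using HG[OF \<sigma>] by simp
    also have "\<dots> = (\<Sum>\<alpha>\<in>A. \<nu> \<alpha> *\<^sub>R (act (inv \<sigma>) \<alpha> - act (inv \<sigma>) \<beta>))"
      unfolding \<beta> by (rule sum_act[OF HG[OF \<sigma>] A])
    also have "\<dots> = act (inv \<sigma>) (\<Sum>\<alpha>\<in>A. \<nu> \<alpha> *\<^sub>R (\<alpha> - \<beta>))"
      by (simp add: linear_sum[OF linear_act] linear_scale[OF linear_act] linear_diff[OF linear_act])
    also have "\<dots> = 0"
      using bal by (simp add: linear_0[OF linear_act])
    finally show ?thesis .
  qed
  have "(\<Sum>\<alpha>\<in>A. \<nu>' \<alpha> *\<^sub>R (\<alpha> - \<beta>))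
      = (1 / N) *\<^sub>R (\<Sum>\<sigma>\<in>H. \<Sum>\<alpha>\<in>A. \<nu> (act \<sigma> \<alpha>) *\<^sub>R (\<alpha> - \<beta>))"
    by (subst sum.swap) (simp add: \<nu>'_def scaleR_sum_right scaleR_sum_left sum_divide_distrib)
  then have bal': "(\<Sum>\<alpha>\<in>A. \<nu>' \<alpha> *\<^sub>R (\<alpha> - \<beta>)) = 0"
    by (simp add: bal_\<sigma>)
  have supp': "\<nu>' \<alpha> = 0" if "\<alpha> \<in> A" "k \<alpha> = 0" for \<alpha>
    unfolding \<nu>'_def using that supp k_inv' A HG by simp
  let ?E = "\<lambda>\<alpha>. \<nu> \<alpha> * ln (\<nu> \<alpha>) - \<nu> \<alpha> * (1 + ln (k \<alpha>))"
  have "(\<Sum>\<alpha>\<in>A. \<nu>' \<alpha> * ln (\<nu>' \<alpha>) - \<nu>' \<alpha> * (1 + ln (k \<alpha>)))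
      \<le> (\<Sum>\<alpha>\<in>A. (\<Sum>\<sigma>\<in>H. ?E (act \<sigma> \<alpha>)) / N)"
  proof (rule sum_mono)
    fix \<alpha> assume \<alpha>: "\<alpha> \<in> A"
    have "\<nu>' \<alpha> * ln (\<nu>' \<alpha>) \<le> (\<Sum>\<sigma>\<in>H. \<nu> (act \<sigma> \<alpha>) * ln (\<nu> (act \<sigma> \<alpha>))) / N"
      unfolding \<nu>'_def N_def using \<alpha> by (intro entropy_mean_le fin ne \<nu>0 A HG)
    \<comment> \<open>This part is linear in \<nu>, and \<open>k\<close> is constant along the
      translates, so it averages exactly; convexity is needed only for the term above.\<close>
    moreover have "\<nu>' \<alpha> * (1 + ln (k \<alpha>)) = (\<Sum>\<sigma>\<in>H. \<nu> (act \<sigma> \<alpha>) * (1 + ln (k (act \<sigma> \<alpha>)))) / N"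
      using k_inv' \<alpha> by (simp add: \<nu>'_def sum_distrib_right)
    ultimately show "\<nu>' \<alpha> * ln (\<nu>' \<alpha>) - \<nu>' \<alpha> * (1 + ln (k \<alpha>)) \<le> (\<Sum>\<sigma>\<in>H. ?E (act \<sigma> \<alpha>)) / N"
      by (simp add: sum_subtractf diff_divide_distrib)
  qed
  also have "\<dots> = (\<Sum>\<sigma>\<in>H. \<Sum>\<alpha>\<in>A. ?E (act \<sigma> \<alpha>)) / N"
    unfolding sum_divide_distrib[symmetric] by (subst sum.swap) (rule refl)
  also have "\<dots> = (\<Sum>\<sigma>\<in>H. \<Sum>\<alpha>\<in>A. ?E \<alpha>) / N"
    using sum_act[OF HG A, where h = ?E] by simp
  also have "\<dots> \<le> b"
    using ent' N by (simp add: N_def)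
  finally have "rel_entropy A \<nu>' (\<lambda>\<alpha>. exp 1 * k \<alpha>) \<le> ereal b"
    using supp' by (subst rel_entropy_le_iff[OF assms(1) k0 \<nu>'0]) auto
  then show ?thesis
    using \<nu>'0 inv' bal' by blast
qed

section \<open>Orbit representatives and right cosets\<close>

text \<open>If two distinct representatives shared an orbit, one could be dropped without changing
  the union of orbits, against minimality.\<close>

lemma orbit_representative_unique:
  assumes R: "orbit_representatives G act B R" and "\<beta> \<in> R" "\<beta>' \<in> R"
    and \<sigma>: "\<sigma> \<in> carrier G" and eq: "\<beta>' = act \<sigma> \<beta>"
  shows "\<beta> = \<beta>'"
proof (rule ccontr)
  assume "\<beta> \<noteq> \<beta>'"
  have "orbit G act \<beta>' \<subseteq> orbit G act \<beta>"
    using \<sigma> by (auto simp: orbit_def eq act_mult[symmetric])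
  then have "(\<Union>\<gamma>\<in>R - {\<beta>'}. orbit G act \<gamma>) = (\<Union>\<gamma>\<in>R. orbit G act \<gamma>)"
    using \<open>\<beta> \<noteq> \<beta>'\<close> assms(2) by blast
  moreover have "R - {\<beta>'} \<subset> R"
    using assms(3) by blast
  ultimately show False
    using R unfolding orbit_representatives_def by blast
qed

text \<open>For right cosets of the stabilizer it is the inverse that gives a well-defined point of
  the orbit: \<open>inv (h \<otimes> \<sigma>)\<close> maps \<beta> where
  \<open>inv \<sigma>\<close> does if \<open>h\<close> fixes \<beta>. This is the orbit-stabilizer
  correspondence, applied to all orbits in B at once, and it turns the double sum of the theorem
  into a sum over B.\<close>

lemma bij_betw_coset_representatives:
  assumes R: "orbit_representatives G act B R"
    and T: "\<And>\<beta>. \<beta> \<in> R \<Longrightarrow> right_coset_representatives G (stab \<beta>) (T \<beta>)"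
  shows "bij_betw (\<lambda>(\<beta>, \<sigma>). act (inv \<sigma>) \<beta>) (Sigma R T) B"
proof -
  have TG: "\<And>\<beta> \<sigma>. \<beta> \<in> R \<Longrightarrow> \<sigma> \<in> T \<beta> \<Longrightarrow> \<sigma> \<in> carrier G"
    using T by (auto simp: right_coset_representatives_def)
  have T1: "\<exists>!\<tau>. \<tau> \<in> T \<beta> \<and> \<tau> \<in> stab \<beta> #> \<sigma>" if "\<beta> \<in> R" "\<sigma> \<in> carrier G" for \<beta> \<sigma>
    using T[OF that(1)] that(2) by (auto simp: right_coset_representatives_def RCOSETS_def)
  have coset: "\<tau> \<in> stab \<beta> #> \<sigma> \<longleftrightarrow> act (inv \<tau>) \<beta> = act (inv \<sigma>) \<beta>"
    if \<sigma>: "\<sigma> \<in> carrier G" and \<tau>: "\<tau> \<in> carrier G" for \<beta> \<sigma> \<tau>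
  proof
    assume "\<tau> \<in> stab \<beta> #> \<sigma>"
    then obtain h where h: "h \<in> carrier G" "act h \<beta> = \<beta>" and "\<tau> = h \<otimes> \<sigma>"
      by (auto simp: r_coset_def stabilizer_def)
    then have "act (inv \<tau>) \<beta> = act (inv \<sigma>) (act (inv h) (act h \<beta>))"
      using \<sigma> by (simp add: inv_mult_group act_mult)
    then show "act (inv \<tau>) \<beta> = act (inv \<sigma>) \<beta>"
      using h(1) by simp
  next
    assume "act (inv \<tau>) \<beta> = act (inv \<sigma>) \<beta>"
    then have "act (\<tau> \<otimes> inv \<sigma>) \<beta> = \<beta>"
      using \<sigma> \<tau> act_act_inv[of \<tau> \<beta>] by (simp add: act_mult)
    then have "\<tau> \<otimes> inv \<sigma> \<in> stab \<beta>"
      using \<sigma> \<tau> by (simp add: stabilizer_def)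
    moreover have "\<tau> = (\<tau> \<otimes> inv \<sigma>) \<otimes> \<sigma>"
      using \<sigma> \<tau> by (simp add: m_assoc)
    ultimately show "\<tau> \<in> stab \<beta> #> \<sigma>"
      unfolding r_coset_def by blast
  qed
  have "inj_on (\<lambda>(\<beta>, \<sigma>). act (inv \<sigma>) \<beta>) (Sigma R T)"
  proof (rule inj_onI, clarify)
    fix \<beta> \<sigma> \<beta>' \<sigma>'
    assume \<beta>: "\<beta> \<in> R" "\<sigma> \<in> T \<beta>" and \<beta>': "\<beta>' \<in> R" "\<sigma>' \<in> T \<beta>'"
      and eq: "act (inv \<sigma>) \<beta> = act (inv \<sigma>') \<beta>'"
    note \<sigma> = TG[OF \<beta>] TG[OF \<beta>']
    have "\<beta>' = act \<sigma>' (act (inv \<sigma>') \<beta>')"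
      using \<sigma>(2) by simp
    also have "\<dots> = act (\<sigma>' \<otimes> inv \<sigma>) \<beta>"
      using \<sigma> by (simp add: eq[symmetric] act_mult)
    finally have "\<beta> = \<beta>'"
      by (rule orbit_representative_unique[OF R \<beta>(1) \<beta>'(1), rotated]) (use \<sigma> in simp)
    moreover from this have "\<sigma> \<in> stab \<beta> #> \<sigma>" "\<sigma>' \<in> stab \<beta> #> \<sigma>"
      using \<sigma> eq by (simp_all add: coset)
    ultimately show "\<beta> = \<beta>' \<and> \<sigma> = \<sigma>'"
      using T1[OF \<beta>(1) \<sigma>(1)] \<beta> \<beta>' by blast
  qed
  moreover have "(\<lambda>(\<beta>, \<sigma>). act (inv \<sigma>) \<beta>) ` Sigma R T = B"
  proof
    have "act (inv \<sigma>) \<beta> \<in> B" if "\<beta> \<in> R" "\<sigma> \<in> T \<beta>" for \<beta> \<sigma>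
    proof -
      have "act (inv \<sigma>) \<beta> \<in> orbit G act \<beta>"
        using TG[OF that] unfolding orbit_def by blast
      moreover have "orbit G act \<beta> \<subseteq> B"
        using R that(1) unfolding orbit_representatives_def by blast
      ultimately show ?thesis
        by blast
    qed
    then show "(\<lambda>(\<beta>, \<sigma>). act (inv \<sigma>) \<beta>) ` Sigma R T \<subseteq> B"
      by auto
    show "B \<subseteq> (\<lambda>(\<beta>, \<sigma>). act (inv \<sigma>) \<beta>) ` Sigma R T"
    proof
      fix \<gamma> assume "\<gamma> \<in> B"
      then obtain \<beta> \<sigma> where \<beta>: "\<beta> \<in> R" and \<sigma>: "\<sigma> \<in> carrier G" and \<gamma>: "\<gamma> = act \<sigma> \<beta>"
        using R by (auto simp: orbit_representatives_def orbit_def)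
      \<comment> \<open>The coset of \<open>inv \<sigma>\<close> is the right one because its
        elements are inverted again before they act.\<close>
      obtain \<tau> where \<tau>: "\<tau> \<in> T \<beta>" "\<tau> \<in> stab \<beta> #> inv \<sigma>"
        using T1[OF \<beta>, of "inv \<sigma>"] \<sigma> by auto
      then have "\<gamma> = act (inv \<tau>) \<beta>"
        using coset[of "inv \<sigma>" \<tau> \<beta>] TG[OF \<beta>] \<sigma> by (simp add: \<gamma>)
      then show "\<gamma> \<in> (\<lambda>(\<beta>, \<sigma>). act (inv \<sigma>) \<beta>) ` Sigma R T"
        using \<beta> \<tau>(1) by force
    qed
  qed
  ultimately show ?thesis
    by (simp add: bij_betw_def)
qed

end

section \<open>Passage between certificates on B and on orbit representatives\<close>

theorem theorem4p1:
  fixes G :: "('g, 'm) monoid_scheme"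
    and \<phi> :: "'g \<Rightarrow> real^'n^'n"
    and A B Bhat :: "(real^'n) set"
    and c f :: "real^'n \<Rightarrow> real"
    and T :: "real^'n \<Rightarrow> 'g set"
  assumes "group G" and "finite (carrier G)"
    and "\<phi> \<in> hom G GL"
    and "finite A" and "A \<noteq> {}" and "finite B" and "B \<noteq> {}" and "A \<inter> B = {}"
    and "\<And>\<alpha>. \<alpha> \<in> A \<Longrightarrow> c \<alpha> > 0"
    and "\<And>\<beta>. \<beta> \<in> B \<Longrightarrow> c \<beta> < 0"
    and "f = (\<lambda>x. signomial A c x + signomial B c x)"
    and "\<And>\<sigma>. \<sigma> \<in> carrier G \<Longrightarrow> fun_action G \<phi> \<sigma> f = f"
    and "orbit_representatives G (dual_action G \<phi>) B Bhat"
    and "\<And>\<beta>. \<beta> \<in> Bhat \<Longrightarrow>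
           right_coset_representatives G (stabilizer G (dual_action G \<phi>) \<beta>) (T \<beta>)"
  shows "f \<in> C_SAGE A B \<longleftrightarrow>
    (\<exists>cs \<nu> :: real^'n \<Rightarrow> real^'n \<Rightarrow> real.
       (\<forall>\<beta>\<in>Bhat.
          cs \<beta> \<in> A \<rightarrow>\<^sub>E {0..} \<and> \<nu> \<beta> \<in> A \<rightarrow>\<^sub>E {0..} \<and>
          invariant_vector (dual_action G \<phi>) (stabilizer G (dual_action G \<phi>) \<beta>) A (cs \<beta>) \<and>
          invariant_vector (dual_action G \<phi>) (stabilizer G (dual_action G \<phi>) \<beta>) A (\<nu> \<beta>)) \<and>
       (\<forall>\<beta>\<in>Bhat. (\<Sum>\<alpha>\<in>A. \<nu> \<beta> \<alpha> *\<^sub>R (\<alpha> - \<beta>)) = 0) \<and>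
       (\<forall>\<beta>\<in>Bhat. rel_entropy A (\<nu> \<beta>) (\<lambda>\<alpha>. exp 1 * cs \<beta> \<alpha>) \<le> ereal (c \<beta>)) \<and>
       (\<forall>\<alpha>\<in>A. (\<Sum>\<beta>\<in>Bhat. \<Sum>\<sigma>\<in>T \<beta>. cs \<beta> (dual_action G \<phi> \<sigma> \<alpha>)) \<le> c \<alpha>))"
proof -
  interpret linear_group_action G \<phi>
    using assms(1-3) by (simp add: linear_group_action_def linear_group_action_axioms_def)
  have neg: "\<And>\<beta>. \<beta> \<in> B \<Longrightarrow> c \<beta> < 0" and pos: "\<And>\<alpha>. \<alpha> \<in> A \<Longrightarrow> 0 < c \<alpha>"
    using assms(9,10) by auto
  have f_U: "f = signomial (A \<union> B) c"
    using assms(4,6,8,11) by (simp add: signomial_def sum.union_disjoint fun_eq_iff)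
  have "act \<sigma> \<gamma> \<in> A \<union> B \<and> c (act \<sigma> \<gamma>) = c \<gamma>" if "\<sigma> \<in> carrier G" "\<gamma> \<in> A \<union> B" for \<sigma> \<gamma>
    using assms(4,6,12) that pos neg
    by (intro signomial_invariant_coefficients) (force simp: f_U)+
  then have U_inv: "\<And>\<sigma> \<gamma>. \<sigma> \<in> carrier G \<Longrightarrow> \<gamma> \<in> A \<union> B \<Longrightarrow> act \<sigma> \<gamma> \<in> A \<union> B"
    and c_inv: "\<And>\<sigma> \<gamma>. \<sigma> \<in> carrier G \<Longrightarrow> \<gamma> \<in> A \<union> B \<Longrightarrow> c (act \<sigma> \<gamma>) = c \<gamma>"
    by blast+
  \<comment> \<open>The action preserves coefficients, hence their signs, and the sign decides
    between A and B.\<close>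
  have A_inv: "act \<sigma> \<alpha> \<in> A" if "\<sigma> \<in> carrier G" "\<alpha> \<in> A" for \<sigma> \<alpha>
    using U_inv[of \<sigma> \<alpha>] c_inv[of \<sigma> \<alpha>] pos[of \<alpha>] neg[of "act \<sigma> \<alpha>"] that by force
  have B_inv: "act \<sigma> \<beta> \<in> B" if "\<sigma> \<in> carrier G" "\<beta> \<in> B" for \<sigma> \<beta>
    using U_inv[of \<sigma> \<beta>] c_inv[of \<sigma> \<beta>] neg[of \<beta>] pos[of "act \<sigma> \<beta>"] that by force
  have Bhat: "Bhat \<subseteq> B"
    using assms(13) by (simp add: orbit_representatives_def)
  then have "finite Bhat"
    using assms(6) finite_subset by blast
  have TG: "\<And>\<beta> \<sigma>. \<beta> \<in> Bhat \<Longrightarrow> \<sigma> \<in> T \<beta> \<Longrightarrow> \<sigma> \<in> carrier G"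
    using assms(14) by (auto simp: right_coset_representatives_def)
  then have fin_T: "\<And>\<beta>. \<beta> \<in> Bhat \<Longrightarrow> finite (T \<beta>)"
    using finite_carrier by (meson finite_subset subsetI)
  have bij: "bij_betw (\<lambda>(\<beta>, \<sigma>). act (inv\<^bsub>G\<^esub> \<sigma>) \<beta>) (Sigma Bhat T) B"
    using assms(13,14) by (rule bij_betw_coset_representatives)
  have f_C_SAGE: "f \<in> C_SAGE A B \<longleftrightarrow>
    (\<exists>p. (\<forall>\<beta>\<in>B. \<forall>\<alpha>\<in>A. 0 \<le> p \<beta> \<alpha>) \<and>
         (\<forall>\<beta>\<in>B. \<forall>x. 0 \<le> signomial A (p \<beta>) x + c \<beta> * exp (\<beta> \<bullet> x)) \<and>
         (\<forall>\<alpha>\<in>A. (\<Sum>\<beta>\<in>B. p \<beta> \<alpha>) = c \<alpha>))"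
    unfolding assms(11) using assms(4,6,8) neg by (rule C_SAGE_iff)
  show ?thesis (is "_ \<longleftrightarrow> ?certificates")
  proof
    assume "f \<in> C_SAGE A B"
    then obtain p where p: "\<And>\<beta> \<alpha>. \<beta> \<in> B \<Longrightarrow> \<alpha> \<in> A \<Longrightarrow> 0 \<le> p \<beta> \<alpha>"
      "\<And>\<beta> x. \<beta> \<in> B \<Longrightarrow> 0 \<le> signomial A (p \<beta>) x + c \<beta> * exp (\<beta> \<bullet> x)"
      "\<And>\<alpha>. \<alpha> \<in> A \<Longrightarrow> (\<Sum>\<beta>\<in>B. p \<beta> \<alpha>) = c \<alpha>"
      unfolding f_C_SAGE by blast
    obtain q where q0: "\<And>\<beta> \<alpha>. \<beta> \<in> B \<Longrightarrow> \<alpha> \<in> A \<Longrightarrow> 0 \<le> q \<beta> \<alpha>"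
      and nonneg: "\<And>\<beta> x. \<beta> \<in> B \<Longrightarrow> 0 \<le> signomial A (q \<beta>) x + c \<beta> * exp (\<beta> \<bullet> x)"
      and total: "\<And>\<alpha>. \<alpha> \<in> A \<Longrightarrow> (\<Sum>\<beta>\<in>B. q \<beta> \<alpha>) = c \<alpha>"
      and q_inv: "\<And>\<tau> \<beta> \<alpha>. \<tau> \<in> carrier G \<Longrightarrow> \<beta> \<in> B \<Longrightarrow> \<alpha> \<in> A \<Longrightarrow>
        q (act \<tau> \<beta>) (act \<tau> \<alpha>) = q \<beta> \<alpha>"
      using average_age_family[OF A_inv B_inv c_inv p] by blast
    have stab_inv: "invariant_vector act (stab \<beta>) A (q \<beta>)" if "\<beta> \<in> B" for \<beta>
      using q_inv[OF _ that] unfolding invariant_vector_def stabilizer_def by fastforce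
    have "\<forall>\<beta>\<in>B. \<exists>\<nu>. (\<forall>\<alpha>\<in>A. 0 \<le> \<nu> \<alpha>) \<and> invariant_vector act (stab \<beta>) A \<nu> \<and>
        (\<Sum>\<alpha>\<in>A. \<nu> \<alpha> *\<^sub>R (\<alpha> - \<beta>)) = 0 \<and> rel_entropy A \<nu> (\<lambda>\<alpha>. exp 1 * q \<beta> \<alpha>) \<le> ereal (c \<beta>)"
    proof
      fix \<beta> assume \<beta>: "\<beta> \<in> B"
      obtain \<nu> where "\<And>\<alpha>. \<alpha> \<in> A \<Longrightarrow> 0 \<le> \<nu> \<alpha>" "(\<Sum>\<alpha>\<in>A. \<nu> \<alpha> *\<^sub>R (\<alpha> - \<beta>)) = 0"
        "rel_entropy A \<nu> (\<lambda>\<alpha>. exp 1 * q \<beta> \<alpha>) \<le> ereal (c \<beta>)"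
        using entropy_if_age_nonneg[OF assms(4) q0[OF \<beta>] nonneg[OF \<beta>]] by blast
      then show "\<exists>\<nu>. (\<forall>\<alpha>\<in>A. 0 \<le> \<nu> \<alpha>) \<and> invariant_vector act (stab \<beta>) A \<nu> \<and>
        (\<Sum>\<alpha>\<in>A. \<nu> \<alpha> *\<^sub>R (\<alpha> - \<beta>)) = 0 \<and> rel_entropy A \<nu> (\<lambda>\<alpha>. exp 1 * q \<beta> \<alpha>) \<le> ereal (c \<beta>)"
        using assms(4) A_inv q0[OF \<beta>] stab_inv[OF \<beta>]
        by (intro average_entropy_certificate[where \<nu> = \<nu>]) auto
    qed
    from bchoice[OF this] obtain \<nu> where \<nu>: "\<And>\<beta> \<alpha>. \<beta> \<in> B \<Longrightarrow> \<alpha> \<in> A \<Longrightarrow> 0 \<le> \<nu> \<beta> \<alpha>"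
      "\<And>\<beta>. \<beta> \<in> B \<Longrightarrow> invariant_vector act (stab \<beta>) A (\<nu> \<beta>)"
      "\<And>\<beta>. \<beta> \<in> B \<Longrightarrow> (\<Sum>\<alpha>\<in>A. \<nu> \<beta> \<alpha> *\<^sub>R (\<alpha> - \<beta>)) = 0"
      "\<And>\<beta>. \<beta> \<in> B \<Longrightarrow> rel_entropy A (\<nu> \<beta>) (\<lambda>\<alpha>. exp 1 * q \<beta> \<alpha>) \<le> ereal (c \<beta>)"
      by blast
    \<comment> \<open>Vectors indexed by A are extensional functions, so the constructed ones are
      cut off outside A. Invariance survives because A is stable under the action.\<close>
    have restrict_inv: "invariant_vector act (stab \<beta>) A (restrict v A)"
      if "invariant_vector act (stab \<beta>) A v" for v :: "real^'n \<Rightarrow> real" and \<beta>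
      using that A_inv by (simp add: invariant_vector_def stabilizer_def)
    have restrict_ent: "rel_entropy A (restrict v A) (\<lambda>\<alpha>. exp 1 * restrict k A \<alpha>)
        = rel_entropy A v (\<lambda>\<alpha>. exp 1 * k \<alpha>)" for v k :: "real^'n \<Rightarrow> real"
      unfolding rel_entropy_def by (rule sum.cong) simp_all
    \<comment> \<open>Equivariance under \<open>inv \<sigma>\<close> moves the translation from
      \<alpha> to \<beta>. The pairs then run through B once, so this direction even yields
      equality.\<close>
    have "(\<Sum>\<beta>\<in>Bhat. \<Sum>\<sigma>\<in>T \<beta>. restrict (q \<beta>) A (act \<sigma> \<alpha>)) = c \<alpha>" if \<alpha>: "\<alpha> \<in> A" for \<alpha>
    proof -
      have "(\<Sum>\<beta>\<in>Bhat. \<Sum>\<sigma>\<in>T \<beta>. restrict (q \<beta>) A (act \<sigma> \<alpha>))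
          = (\<Sum>\<beta>\<in>Bhat. \<Sum>\<sigma>\<in>T \<beta>. q (act (inv\<^bsub>G\<^esub> \<sigma>) \<beta>) \<alpha>)"
      proof (intro sum.cong refl)
        fix \<beta> \<sigma> assume \<beta>: "\<beta> \<in> Bhat" "\<sigma> \<in> T \<beta>"
        then show "restrict (q \<beta>) A (act \<sigma> \<alpha>) = q (act (inv\<^bsub>G\<^esub> \<sigma>) \<beta>) \<alpha>"
          using q_inv[of "inv\<^bsub>G\<^esub> \<sigma>" \<beta> "act \<sigma> \<alpha>"] TG[OF \<beta>] A_inv[OF TG[OF \<beta>] \<alpha>] Bhat by auto
      qed
      also have "\<dots> = (\<Sum>(\<beta>, \<sigma>)\<in>Sigma Bhat T. q (act (inv\<^bsub>G\<^esub> \<sigma>) \<beta>) \<alpha>)"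
        using \<open>finite Bhat\<close> fin_T by (intro sum.Sigma) auto
      also have "\<dots> = (\<Sum>\<beta>\<in>B. q \<beta> \<alpha>)"
        using sum.reindex_bij_betw[OF bij, of "\<lambda>\<beta>. q \<beta> \<alpha>"] by (simp add: case_prod_unfold)
      finally show ?thesis
        using total[OF \<alpha>] by simp
    qed
    then show ?certificates
      using Bhat q0 \<nu> stab_inv restrict_inv restrict_ent
      by (intro exI[of _ "\<lambda>\<beta>. restrict (q \<beta>) A"] exI[of _ "\<lambda>\<beta>. restrict (\<nu> \<beta>) A"]) auto
  next
    assume ?certificates
    then obtain cs \<nu> where
      ent: "\<forall>\<beta>\<in>Bhat. rel_entropy A (\<nu> \<beta>) (\<lambda>\<alpha>. exp 1 * cs \<beta> \<alpha>) \<le> ereal (c \<beta>)"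
      and bal: "\<forall>\<beta>\<in>Bhat. (\<Sum>\<alpha>\<in>A. \<nu> \<beta> \<alpha> *\<^sub>R (\<alpha> - \<beta>)) = 0"
      and total: "\<forall>\<alpha>\<in>A. (\<Sum>\<beta>\<in>Bhat. \<Sum>\<sigma>\<in>T \<beta>. cs \<beta> (act \<sigma> \<alpha>)) \<le> c \<alpha>"
      and PiE: "\<forall>\<beta>\<in>Bhat. cs \<beta> \<in> A \<rightarrow>\<^sub>E {0..} \<and> \<nu> \<beta> \<in> A \<rightarrow>\<^sub>E {0..}"
      by (elim exE conjE, intro that) (assumption | simp)+
    have cs0: "\<And>\<beta> \<alpha>. \<beta> \<in> Bhat \<Longrightarrow> \<alpha> \<in> A \<Longrightarrow> 0 \<le> cs \<beta> \<alpha>"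
      and \<nu>0: "\<And>\<beta> \<alpha>. \<beta> \<in> Bhat \<Longrightarrow> \<alpha> \<in> A \<Longrightarrow> 0 \<le> \<nu> \<beta> \<alpha>"
      using PiE by (auto simp: PiE_iff)
    \<comment> \<open>Each \<delta> in B is \<open>act (inv \<sigma>) \<beta>\<close> for exactly
      one pair of a representative and a coset representative; \<open>p \<delta>\<close> is the
      coefficient vector of \<beta> carried to \<delta> along \<sigma>.\<close>
    define idx where "idx = the_inv_into (Sigma Bhat T) (\<lambda>(\<beta>, \<sigma>). act (inv\<^bsub>G\<^esub> \<sigma>) \<beta>)"
    define p where "p = (\<lambda>\<delta> \<alpha>. case idx \<delta> of (\<beta>, \<sigma>) \<Rightarrow> cs \<beta> (act \<sigma> \<alpha>))"
    have idx: "idx (act (inv\<^bsub>G\<^esub> \<sigma>) \<beta>) = (\<beta>, \<sigma>)" if "\<beta> \<in> Bhat" "\<sigma> \<in> T \<beta>" for \<beta> \<sigma>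
      using the_inv_into_f_f[OF bij_betw_imp_inj_on[OF bij], of "(\<beta>, \<sigma>)"] that
      by (simp add: idx_def)
    have rep: "\<exists>\<beta>\<in>Bhat. \<exists>\<sigma>\<in>T \<beta>. \<delta> = act (inv\<^bsub>G\<^esub> \<sigma>) \<beta>" if "\<delta> \<in> B" for \<delta>
      using bij_betw_imp_surj_on[OF bij] that by force
    have p0: "0 \<le> p \<delta> \<alpha>" if \<delta>: "\<delta> \<in> B" and \<alpha>: "\<alpha> \<in> A" for \<delta> \<alpha>
    proof -
      obtain \<beta> \<sigma> where \<beta>: "\<beta> \<in> Bhat" "\<sigma> \<in> T \<beta>" and "\<delta> = act (inv\<^bsub>G\<^esub> \<sigma>) \<beta>"
        using rep[OF \<delta>] by blast
      then show ?thesis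
        using cs0[OF \<beta>(1) A_inv[OF TG[OF \<beta>] \<alpha>]] by (simp add: p_def idx[OF \<beta>])
    qed
    have nonneg: "0 \<le> signomial A (p \<delta>) x + c \<delta> * exp (\<delta> \<bullet> x)" if \<delta>: "\<delta> \<in> B" for \<delta> x
    proof -
      obtain \<beta> \<sigma> where \<beta>: "\<beta> \<in> Bhat" "\<sigma> \<in> T \<beta>" and \<delta>_eq: "\<delta> = act (inv\<^bsub>G\<^esub> \<sigma>) \<beta>"
        using rep[OF \<delta>] by blast
      note \<sigma> = TG[OF \<beta>]
      have \<beta>_eq: "act \<sigma> \<delta> = \<beta>"
        using \<sigma> by (simp add: \<delta>_eq)
      have "c \<delta> = c \<beta>"
        using c_inv[OF \<sigma>, of \<delta>] \<delta> by (simp add: \<beta>_eq)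
      moreover have "p \<delta> = (\<lambda>\<alpha>. cs \<beta> (act \<sigma> \<alpha>))"
        by (simp add: p_def \<delta>_eq idx[OF \<beta>])
      moreover have "0 \<le> signomial A (\<lambda>\<alpha>. cs \<beta> (act \<sigma> \<alpha>)) x + c \<beta> * exp (\<delta> \<bullet> x)"
        using age_nonneg_if_entropy[OF assms(4) cs0[OF \<beta>(1)] \<nu>0[OF \<beta>(1)] bspec[OF bal \<beta>(1)] bspec[OF ent \<beta>(1)]]
        by (intro age_nonneg_act[OF \<sigma> A_inv]) (simp_all add: \<beta>_eq)
      ultimately show ?thesis
        by simp
    qed
    have p_total: "(\<Sum>\<delta>\<in>B. p \<delta> \<alpha>) \<le> c \<alpha>" if "\<alpha> \<in> A" for \<alpha>
    proof -
      have "(\<Sum>\<delta>\<in>B. p \<delta> \<alpha>) = (\<Sum>(\<beta>, \<sigma>)\<in>Sigma Bhat T. p (act (inv\<^bsub>G\<^esub> \<sigma>) \<beta>) \<alpha>)"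
        using sum.reindex_bij_betw[OF bij, of "\<lambda>\<delta>. p \<delta> \<alpha>"] by (simp add: case_prod_unfold)
      also have "\<dots> = (\<Sum>\<beta>\<in>Bhat. \<Sum>\<sigma>\<in>T \<beta>. p (act (inv\<^bsub>G\<^esub> \<sigma>) \<beta>) \<alpha>)"
        using \<open>finite Bhat\<close> fin_T by (intro sum.Sigma[symmetric]) auto
      also have "\<dots> = (\<Sum>\<beta>\<in>Bhat. \<Sum>\<sigma>\<in>T \<beta>. cs \<beta> (act \<sigma> \<alpha>))"
        by (simp add: p_def idx)
      also have "\<dots> \<le> c \<alpha>"
        by (rule bspec[OF total that])
      finally show ?thesis .
    qed
    obtain \<delta>0 where \<delta>0: "\<delta>0 \<in> B"
      using assms(7) by blast
    \<comment> \<open>The certificates only bound the coefficients of f, whereas a decomposition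
      must match them. The remainder goes to one arbitrary summand \<open>\<delta>0\<close>; larger
      coefficients on A keep it nonnegative.\<close>
    define slack where "slack = (\<lambda>\<alpha>. c \<alpha> - (\<Sum>\<delta>\<in>B. p \<delta> \<alpha>))"
    have slack: "\<And>\<alpha>. \<alpha> \<in> A \<Longrightarrow> 0 \<le> slack \<alpha>"
      using p_total by (simp add: slack_def)
    define r where "r = (\<lambda>\<delta> \<alpha>. p \<delta> \<alpha> + (if \<delta> = \<delta>0 then slack \<alpha> else 0))"
    have r_ge: "p \<delta> \<alpha> \<le> r \<delta> \<alpha>" if "\<alpha> \<in> A" for \<delta> \<alpha>
      using slack[OF that] by (simp add: r_def)
    have "0 \<le> r \<delta> \<alpha>" if "\<delta> \<in> B" "\<alpha> \<in> A" for \<delta> \<alpha>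
      using p0[OF that] r_ge[OF that(2)] by (rule order_trans)
    moreover have "0 \<le> signomial A (r \<delta>) x + c \<delta> * exp (\<delta> \<bullet> x)" if "\<delta> \<in> B" for \<delta> x
    proof -
      have "signomial A (p \<delta>) x \<le> signomial A (r \<delta>) x"
        unfolding signomial_def by (intro sum_mono mult_right_mono r_ge) auto
      then show ?thesis
        using nonneg[OF that, of x] by linarith
    qed
    moreover have "(\<Sum>\<delta>\<in>B. r \<delta> \<alpha>) = c \<alpha>" for \<alpha>
      using assms(6) \<delta>0 by (simp add: r_def sum.distrib slack_def)
    ultimately show "f \<in> C_SAGE A B"
      unfolding f_C_SAGE by (intro exI[of _ r]) simp
  qed
qed

end
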